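(* Let $F$ be a Finsler metric on a manifold $M$ of scalar flag curvature $\mathbf K=\mathbf K(x,y)$. Then for all indices $i,j,k$, $$(\mathbf K_{\cdot j|i}-\mathbf K_{\cdot i|j})F_{\cdot k}+(\mathbf K_{\cdot i|k}-\mathbf K_{\cdot k|i})F_{\cdot j}+(\mathbf K_{\cdot k|j}-\mathbf K_{\cdot j|k})F_{\cdot i}=0.$$
   Context: A Finsler metric on a manifold $M$ is a function $F=F(x,y)$ on $TM$, $C^\infty$ on $TM\setminus\{0\}$, with $F\ge 0$ and $F(x,y)=0$ iff $y=0$, $F(x,\lambda y)=\lambda F(x,y)$ for $\lambda\ge 0$, and with $g_{ij}=\frac12 [F^2]_{y^iy^j}$ positive definite for $y\ne0$. Geodesic coefficients: $G^i=\frac14 g^{il}\{[F^2]_{x^my^l}y^m-[F^2]_{x^l}\}$. Riemann curvature: $R^i_{\ k}=2\frac{\partial G^i}{\partial x^k}-\frac{\partial^2G^i}{\partial x^l\partial y^k}y^l+2G^l\frac{\partial^2G^i}{\partial y^l\partial y^k}-\frac{\partial G^i}{\partial y^l}\frac{\partial G^l}{\partial y^k}$. $F$ is of scalar flag curvature $\mathbf K=\mathbf K(x,y)$ if $R^i_{\ k}=\mathbf K\{F^2\delta^i_k-FF_{y^k}y^i\}$. Notation: $T_{\cdot k}=\partial T/\partial y^k$. The symbol "$|$" denotes the horizontal covariant derivative of the Berwald connection: for a covector $T_i(x,y)$, $T_{i|j}=\frac{\partial T_i}{\partial x^j}-\frac{\partial G^m}{\partial y^j}\frac{\partial T_i}{\partial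 y^m}-\frac{\partial^2G^m}{\partial y^i\partial y^j}T_m$. $\mathbf K_{\cdot i|j}$ is the covariant derivative of the covector $\mathbf K_{\cdot i}$. *)

theory Defs
  imports "HOL-Analysis.Analysis"
begin

section \<open>Smooth maps and smooth manifolds\<close>

text \<open>The set \<open>S\<close> is meant to be open: derivatives are taken in the ambient space.\<close>

primrec Ck_on :: "nat \<Rightarrow> ('a::real_normed_vector \<Rightarrow> 'b::real_normed_vector) \<Rightarrow> 'a set \<Rightarrow> bool"
  where
    "Ck_on 0 f S \<longleftrightarrow> continuous_on S f"
  | "Ck_on (Suc k) f S \<longleftrightarrow>
       (\<forall>x\<in>S. f differentiable (at x)) \<and>
       (\<forall>v. Ck_on k (\<lambda>x. frechet_derivative f (at x) v) S)"

definition smooth_on :: "('a::real_normed_vector \<Rightarrow> 'b::real_normed_vector) \<Rightarrow> 'a set \<Rightarrow> bool"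
  where "smooth_on f S \<longleftrightarrow> (\<forall>k. Ck_on k f S)"

text \<open>A chart is a pair \<open>(U, \<phi>)\<close>; the values of \<open>\<phi>\<close> outside \<open>U\<close> are irrelevant.\<close>

type_synonym ('m, 'n) chart = "'m set \<times> ('m \<Rightarrow> real^'n)"

abbreviation chart_dom :: "('m, 'n) chart \<Rightarrow> 'm set"
  where "chart_dom c \<equiv> fst c"

abbreviation chart_map :: "('m, 'n) chart \<Rightarrow> 'm \<Rightarrow> real^'n"
  where "chart_map c \<equiv> snd c"

definition chart_range :: "('m, 'n) chart \<Rightarrow> (real^'n) set"
  where "chart_range c = chart_map c ` chart_dom c"

definition chart_inv :: "('m, 'n) chart \<Rightarrow> real^'n \<Rightarrow> 'm"
  where "chart_inv c = inv_into (chart_dom c) (chart_map c)"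

definition transition :: "('m, 'n) chart \<Rightarrow> ('m, 'n) chart \<Rightarrow> real^'n \<Rightarrow> real^'n"
  where "transition c d = chart_map d \<circ> chart_inv c"

definition second_countable_space :: "'m topology \<Rightarrow> bool"
  where "second_countable_space X \<longleftrightarrow>
    (\<exists>\<B>. countable \<B> \<and> (\<forall>V\<in>\<B>. openin X V) \<and>
         (\<forall>U x. openin X U \<and> x \<in> U \<longrightarrow> (\<exists>V\<in>\<B>. x \<in> V \<and> V \<subseteq> U)))"

text \<open>The atlas \<open>A\<close> may be, but need not be, the maximal one. Boundaryless manifolds of
  dimension \<open>CARD('n)\<close>.\<close>

definition smooth_manifold :: "'m topology \<Rightarrow> ('m, 'n::finite) chart set \<Rightarrow> bool"
  where "smooth_manifold X A \<longleftrightarrow>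
    Hausdorff_space X \<and> second_countable_space X \<and>
    (\<Union>c\<in>A. chart_dom c) = topspace X \<and>
    (\<forall>c\<in>A. openin X (chart_dom c) \<and> open (chart_range c) \<and>
       homeomorphic_map (subtopology X (chart_dom c)) (top_of_set (chart_range c)) (chart_map c)) \<and>
    (\<forall>c\<in>A. \<forall>d\<in>A. smooth_on (transition c d) (chart_map c ` (chart_dom c \<inter> chart_dom d)))"

section \<open>Tangent vectors\<close>

text \<open>A tangent vector at \<open>p\<close> is the family of its component vectors in all charts around \<open>p\<close>,
  related by the Jacobians of the transition maps. Components with respect to anything that is
  not a chart around \<open>p\<close> are set to \<open>0\<close>, so that equality of tangent vectors is equality of
  functions and the zero vector is \<open>\<lambda>_. 0\<close>.\<close>

type_synonym ('m, 'n) tvec = "('m, 'n) chart \<Rightarrow> real^'n"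

definition tangent_space :: "('m, 'n::finite) chart set \<Rightarrow> 'm \<Rightarrow> ('m, 'n) tvec set"
  where "tangent_space A p = {v.
    (\<forall>c\<in>A. \<forall>d\<in>A. p \<in> chart_dom c \<and> p \<in> chart_dom d \<longrightarrow>
       v d = frechet_derivative (transition c d) (at (chart_map c p)) (v c)) \<and>
    (\<forall>c. \<not> (c \<in> A \<and> p \<in> chart_dom c) \<longrightarrow> v c = 0)}"

text \<open>The tangent vector \<open>y\<^sup>i \<partial>/\<partial>x\<^sup>i\<close> at \<open>p\<close>, in the coordinates of the chart \<open>c\<close>.\<close>

definition coord_vector ::
    "('m, 'n::finite) chart set \<Rightarrow> ('m, 'n) chart \<Rightarrow> 'm \<Rightarrow> real^'n \<Rightarrow> ('m, 'n) tvec"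
  where "coord_vector A c p y = (\<lambda>d. if d \<in> A \<and> p \<in> chart_dom d
           then frechet_derivative (transition c d) (at (chart_map c p)) y else 0)"

text \<open>A function on the tangent bundle, written in the standard coordinates \<open>(x, y)\<close> of \<open>TM\<close>
  induced by the chart \<open>c\<close>.\<close>

definition local_rep :: "('m, 'n::finite) chart set \<Rightarrow> ('m, 'n) chart \<Rightarrow>
    ('m \<Rightarrow> ('m, 'n) tvec \<Rightarrow> real) \<Rightarrow> (real^'n) \<times> (real^'n) \<Rightarrow> real"
  where "local_rep A c T = (\<lambda>(x, y). T (chart_inv c x) (coord_vector A c (chart_inv c x) y))"

section \<open>Finsler geometry in local coordinates\<close>

definition Dx :: "'n::finite \<Rightarrow> ((real^'n) \<times> (real^'n) \<Rightarrow> real) \<Rightarrow> (real^'n) \<times> (real^'n) \<Rightarrow> real"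
  where "Dx i f = (\<lambda>(x, y). deriv (\<lambda>t. f (x + t *\<^sub>R axis i 1, y)) 0)"

definition Dy :: "'n::finite \<Rightarrow> ((real^'n) \<times> (real^'n) \<Rightarrow> real) \<Rightarrow> (real^'n) \<times> (real^'n) \<Rightarrow> real"
  where "Dy i f = (\<lambda>(x, y). deriv (\<lambda>t. f (x, y + t *\<^sub>R axis i 1)) 0)"

text \<open>Below, \<open>L\<close> is a Finsler metric in local coordinates and \<open>z = (x, y)\<close>.\<close>

definition fund_tensor :: "((real^'n::finite) \<times> (real^'n) \<Rightarrow> real) \<Rightarrow> (real^'n) \<times> (real^'n) \<Rightarrow> real^'n^'n"
  where "fund_tensor L z = (\<chi> i j. 1/2 * Dy j (Dy i (\<lambda>w. (L w)\<^sup>2)) z)"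

definition geod_coeff :: "((real^'n::finite) \<times> (real^'n) \<Rightarrow> real) \<Rightarrow> 'n \<Rightarrow> (real^'n) \<times> (real^'n) \<Rightarrow> real"
  where "geod_coeff L i z = 1/4 * (\<Sum>l\<in>UNIV. matrix_inv (fund_tensor L z) $ i $ l *
    ((\<Sum>m\<in>UNIV. Dy l (Dx m (\<lambda>w. (L w)\<^sup>2)) z * snd z $ m) - Dx l (\<lambda>w. (L w)\<^sup>2) z))"

definition riemann_curv ::
    "((real^'n::finite) \<times> (real^'n) \<Rightarrow> real) \<Rightarrow> 'n \<Rightarrow> 'n \<Rightarrow> (real^'n) \<times> (real^'n) \<Rightarrow> real"
  where "riemann_curv L i k z =
    2 * Dx k (geod_coeff L i) z
    - (\<Sum>l\<in>UNIV. Dy k (Dx l (geod_coeff L i)) z * snd z $ l)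
    + 2 * (\<Sum>l\<in>UNIV. geod_coeff L l z * Dy k (Dy l (geod_coeff L i)) z)
    - (\<Sum>l\<in>UNIV. Dy l (geod_coeff L i) z * Dy k (geod_coeff L l) z)"

text \<open>The horizontal Berwald covariant derivative \<open>T\<^bsub>i|j\<^esub>\<close> of a covector \<open>T\<close>.\<close>

definition berwald_hcov :: "((real^'n::finite) \<times> (real^'n) \<Rightarrow> real) \<Rightarrow>
    ('n \<Rightarrow> (real^'n) \<times> (real^'n) \<Rightarrow> real) \<Rightarrow> 'n \<Rightarrow> 'n \<Rightarrow> (real^'n) \<times> (real^'n) \<Rightarrow> real"
  where "berwald_hcov L T i j z =
    Dx j (T i) z
    - (\<Sum>m\<in>UNIV. Dy j (geod_coeff L m) z * Dy m (T i) z)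
    - (\<Sum>m\<in>UNIV. Dy j (Dy i (geod_coeff L m)) z * T m z)"

section \<open>Finsler metrics on manifolds\<close>

definition finsler_metric ::
    "'m topology \<Rightarrow> ('m, 'n::finite) chart set \<Rightarrow> ('m \<Rightarrow> ('m, 'n) tvec \<Rightarrow> real) \<Rightarrow> bool"
  where "finsler_metric X A F \<longleftrightarrow>
    (\<forall>p\<in>topspace X. \<forall>v\<in>tangent_space A p.
       F p v \<ge> 0 \<and> (F p v = 0 \<longleftrightarrow> v = (\<lambda>_. 0)) \<and>
       (\<forall>t\<ge>0. F p (\<lambda>c. t *\<^sub>R v c) = t * F p v)) \<and>
    (\<forall>c\<in>A. smooth_on (local_rep A c F) (chart_range c \<times> (- {0}))) \<and>
    (\<forall>c\<in>A. \<forall>x\<in>chart_range c. \<forall>y. y \<noteq> 0 \<longrightarrow>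
       (\<forall>u. u \<noteq> 0 \<longrightarrow> u \<bullet> (fund_tensor (local_rep A c F) (x, y) *v u) > 0))"

text \<open>No regularity of \<open>K\<close> is required separately: in dimension at least \<open>2\<close> the equation
  determines \<open>K\<close> off the zero section through the trace of the curvature.\<close>

definition scalar_flag_curvature :: "('m, 'n::finite) chart set \<Rightarrow>
    ('m \<Rightarrow> ('m, 'n) tvec \<Rightarrow> real) \<Rightarrow> ('m \<Rightarrow> ('m, 'n) tvec \<Rightarrow> real) \<Rightarrow> bool"
  where "scalar_flag_curvature A F K \<longleftrightarrow>
    (\<forall>c\<in>A. \<forall>x\<in>chart_range c. \<forall>y. y \<noteq> 0 \<longrightarrow> (\<forall>i k.
       riemann_curv (local_rep A c F) i k (x, y) =
       local_rep A c K (x, y) *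
         ((local_rep A c F (x, y))\<^sup>2 * (if i = k then 1 else 0)
          - local_rep A c F (x, y) * Dy k (local_rep A c F) (x, y) * y $ i)))"

end

(* Work in one chart with E = F^2, the horizontal derivatives d_j = d/dx^j - N^m_j d/dy^m, and
   R^i_kl = d_k N^i_l - d_l N^i_k, so that [d_k, d_l] = - R^m_kl d/dy^m and d_j F = 0. Scalar flag
   curvature means R^m_kl = delta^m_k a_l - delta^m_l a_k + y^m b_kl with
   a_l = F^2 K_.l / 3 + K F F_.l. Inserted into the Bianchi identity, this gives, for A = da the
   horizontal differential, delta^m_k A_lj + cyclic = y^m B_jkl with B totally antisymmetric.
   The trace over m = k and a contraction with y^j give A_lj y^j = 0 when n >= 3, which reads
   4 F d_l K = F P_.l + 3 P F_.l with P = y^j d_j K. Since K_.i|j = (d_j K)_.i, the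
   antisymmetric part of K_.i|j is 3/4 (Q_.i F_.j - Q_.j F_.i) with Q = P / F, and the
   claim follows. When n <= 2 two of the three indices coincide and there is nothing to prove. *)
theory Submission
  imports Defs
begin

section \<open>Smooth functions on open sets\<close>

text \<open>The last step is exterior algebra in the fibre variable: the vertical one-form with
  components d_j K is 1/4 dP + 3/4 Q dF, so its vertical differential is 3/4 dQ wedge dF, and the
  cyclic sum is a wedge product with dF, which kills it. The 1/3 in a_l comes from 3 R^i_kl =
  R^i_k.l - R^i_l.k, a consequence of the vertical Bianchi identity and Euler's theorem. The
  contraction A_lj y^j = 0 compares two evaluations: y^j d_l a_j, where y^j a_j = K F^2, and y^j d_j
  a_l, where P appears. That d_j F = 0 is conservation of energy along the geodesic spray,
  differentiated once in y. Two obstacles shape the setup. \<open>K\<close> is given only through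
  the curvature equation, so its smoothness and its homogeneity of degree zero are extracted from
  the trace (n - 1) K F^2. And every identity holds on an open set only, so homogeneity is used in
  the differential form of Euler's identity, and identities are differentiated by congruence lemmas
  on open sets.\<close>

lemma frechet_derivative_cong_open:
  assumes "open S" "x \<in> S" "\<And>y. y \<in> S \<Longrightarrow> f y = g y"
  shows "frechet_derivative f (at x) = frechet_derivative g (at x)"
proof -
  have "(f has_derivative D) (at x) \<longleftrightarrow> (g has_derivative D) (at x)" for D
    using assms by (metis has_derivative_transform_within_open)
  then show ?thesis by (simp add: frechet_derivative_def)
qed

lemma Ck_on_cong:
  assumes "open S" "\<And>x. x \<in> S \<Longrightarrow> f x = g x" "Ck_on k f S"
  shows "Ck_on k g S"
  using assms(2,3)
proof (induction k arbitrary: f g)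
  case 0
  then show ?case using continuous_on_cong by force
next
  case (Suc k)
  have "g differentiable (at x)" if "x \<in> S" for x
    using Suc.prems that assms(1) unfolding differentiable_def Ck_on.simps
    by (metis has_derivative_transform_within_open)
  moreover have "Ck_on k (\<lambda>x. frechet_derivative g (at x) v) S" for v
    using Suc.IH[of "\<lambda>x. frechet_derivative f (at x) v" "\<lambda>x. frechet_derivative g (at x) v"]
      frechet_derivative_cong_open[OF assms(1), of _ f g] Suc.prems by simp
  ultimately show ?case by simp
qed

lemma Ck_on_SucD: "Ck_on (Suc k) f S \<Longrightarrow> Ck_on k f S"
proof (induction k arbitrary: f)
  case 0
  then show ?case
    by (auto intro!: continuous_at_imp_continuous_on differentiable_imp_continuous_within)
next
  case (Suc k)
  then show ?case by (metis Ck_on.simps(2))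
qed

lemma Ck_on_const: "Ck_on k (\<lambda>x. c) S"
  by (induction k arbitrary: c) (auto simp: frechet_derivative_const)

lemma Ck_on_bounded_linear:
  assumes "bounded_linear f" shows "Ck_on k f S"
proof (cases k)
  case 0
  then show ?thesis using assms by (simp add: linear_continuous_on)
next
  case (Suc l)
  have "(f has_derivative f) (at x)" for x
    using assms by (rule bounded_linear_imp_has_derivative)
  then have "f differentiable (at x)" "frechet_derivative f (at x) = f" for x
    unfolding differentiable_def by (blast, metis frechet_derivative_at)
  then show ?thesis using Suc by (simp add: Ck_on_const)
qed

lemma Ck_on_add:
  assumes "open S" "Ck_on k f S" "Ck_on k g S"
  shows "Ck_on k (\<lambda>x. f x + g x) S"
  using assms(2,3)
proof (induction k arbitrary: f g)
  case 0
  then show ?case by (simp add: continuous_on_add)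
next
  case (Suc k)
  have D: "((\<lambda>x. f x + g x) has_derivative
      (\<lambda>v. frechet_derivative f (at x) v + frechet_derivative g (at x) v)) (at x)"
    if "x \<in> S" for x
    using Suc.prems that by (intro has_derivative_add) (auto simp: frechet_derivative_works[symmetric])
  note eq = frechet_derivative_at[OF D, THEN fun_cong]
  have "Ck_on k (\<lambda>x. frechet_derivative f (at x) v + frechet_derivative g (at x) v) S" for v
    using Suc by simp
  then have "Ck_on k (\<lambda>x. frechet_derivative (\<lambda>x. f x + g x) (at x) v) S" for v
    by (rule Ck_on_cong[OF assms(1) eq[of _ v], rotated])
  then show ?case using D by (auto simp: differentiable_def)
qed

lemma Ck_on_mult:
  fixes f g :: "'a::real_normed_vector \<Rightarrow> real"
  assumes "open S" "Ck_on k f S" "Ck_on k g S"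
  shows "Ck_on k (\<lambda>x. f x * g x) S"
  using assms(2,3)
proof (induction k arbitrary: f g)
  case 0
  then show ?case by (simp add: continuous_on_mult)
next
  case (Suc k)
  have D: "((\<lambda>x. f x * g x) has_derivative
      (\<lambda>v. f x * frechet_derivative g (at x) v + frechet_derivative f (at x) v * g x)) (at x)"
    if "x \<in> S" for x
    using Suc.prems that by (intro has_derivative_mult) (auto simp: frechet_derivative_works[symmetric])
  note eq = frechet_derivative_at[OF D, THEN fun_cong]
  have "Ck_on k f S" "Ck_on k g S" using Suc.prems Ck_on_SucD by blast+
  then have "Ck_on k (\<lambda>x. f x * frechet_derivative g (at x) v
      + frechet_derivative f (at x) v * g x) S" for v
    using Suc by (intro Ck_on_add assms(1) Suc.IH) auto
  then have "Ck_on k (\<lambda>x. frechet_derivative (\<lambda>x. f x * g x) (at x) v) S" for v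
    by (rule Ck_on_cong[OF assms(1) eq[of _ v], rotated])
  then show ?case using D by (auto simp: differentiable_def)
qed

text \<open>The derivative of 1/f is built from f' and 1/f itself, so the induction hypothesis for
  the same \<open>f\<close> suffices, whereas the product rule needs it for other functions.\<close>

lemma Ck_on_inverse:
  fixes f :: "'a::real_normed_vector \<Rightarrow> real"
  assumes "open S" "\<And>x. x \<in> S \<Longrightarrow> f x \<noteq> 0" "Ck_on k f S"
  shows "Ck_on k (\<lambda>x. inverse (f x)) S"
  using assms(3)
proof (induction k)
  case 0
  then show ?case using assms by (auto intro!: continuous_on_inverse)
next
  case (Suc k)
  then have *: "Ck_on k (\<lambda>x. inverse (f x)) S" using Ck_on_SucD by blast
  have D: "((\<lambda>x. inverse (f x)) has_derivative
      (\<lambda>v. - (inverse (f x) * frechet_derivative f (at x) v * inverse (f x)))) (at x)"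
    if "x \<in> S" for x
    using Suc.prems that assms(2)
    by (intro Deriv.has_derivative_inverse) (auto simp: frechet_derivative_works[symmetric])
  note eq = frechet_derivative_at[OF D, THEN fun_cong]
  have "Ck_on k (\<lambda>x. - (inverse (f x) * frechet_derivative f (at x) v * inverse (f x))) S" for v
    using Ck_on_mult[OF assms(1) Ck_on_const[of k "- 1"]
        Ck_on_mult[OF assms(1) Ck_on_mult[OF assms(1) *, of "\<lambda>x. frechet_derivative f (at x) v"] *]]
      Suc.prems by simp
  then have "Ck_on k (\<lambda>x. frechet_derivative (\<lambda>x. inverse (f x)) (at x) v) S" for v
    by (rule Ck_on_cong[OF assms(1) eq[of _ v], rotated])
  then show ?case using D by (auto simp: differentiable_def)
qed

lemma smooth_on_cong:
  assumes "open S" "\<And>x. x \<in> S \<Longrightarrow> f x = g x" "smooth_on f S"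
  shows "smooth_on g S"
  using assms Ck_on_cong[OF assms(1)] unfolding smooth_on_def by blast

lemma smooth_on_const [simp]: "smooth_on (\<lambda>x. c) S"
  by (simp add: smooth_on_def Ck_on_const)

lemma smooth_on_bounded_linear: "bounded_linear f \<Longrightarrow> smooth_on f S"
  by (simp add: smooth_on_def Ck_on_bounded_linear)

lemma smooth_on_add:
  "open S \<Longrightarrow> smooth_on f S \<Longrightarrow> smooth_on g S \<Longrightarrow> smooth_on (\<lambda>x. f x + g x) S"
  by (simp add: smooth_on_def Ck_on_add)

lemma smooth_on_mult:
  fixes f g :: "'a::real_normed_vector \<Rightarrow> real"
  shows "open S \<Longrightarrow> smooth_on f S \<Longrightarrow> smooth_on g S \<Longrightarrow> smooth_on (\<lambda>x. f x * g x) S"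
  by (simp add: smooth_on_def Ck_on_mult)

lemma smooth_on_inverse:
  fixes f :: "'a::real_normed_vector \<Rightarrow> real"
  shows "open S \<Longrightarrow> (\<And>x. x \<in> S \<Longrightarrow> f x \<noteq> 0) \<Longrightarrow> smooth_on f S \<Longrightarrow> smooth_on (\<lambda>x. inverse (f x)) S"
  by (simp add: smooth_on_def Ck_on_inverse)

lemma smooth_on_minus:
  fixes f :: "'a::real_normed_vector \<Rightarrow> real"
  shows "open S \<Longrightarrow> smooth_on f S \<Longrightarrow> smooth_on (\<lambda>x. - f x) S"
  using smooth_on_mult[of S "\<lambda>x. - 1" f] by simp

lemma smooth_on_diff:
  fixes f g :: "'a::real_normed_vector \<Rightarrow> real"
  shows "open S \<Longrightarrow> smooth_on f S \<Longrightarrow> smooth_on g S \<Longrightarrow> smooth_on (\<lambda>x. f x - g x) S"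
  using smooth_on_add[of S f "\<lambda>x. - g x"] smooth_on_minus[of S g] by simp

lemma smooth_on_divide:
  fixes f g :: "'a::real_normed_vector \<Rightarrow> real"
  shows "open S \<Longrightarrow> smooth_on f S \<Longrightarrow> smooth_on g S \<Longrightarrow> (\<And>x. x \<in> S \<Longrightarrow> g x \<noteq> 0) \<Longrightarrow>
    smooth_on (\<lambda>x. f x / g x) S"
  by (simp add: divide_inverse smooth_on_mult smooth_on_inverse)

lemma smooth_on_divide_const:
  fixes f :: "'a::real_normed_vector \<Rightarrow> real"
  shows "open S \<Longrightarrow> smooth_on f S \<Longrightarrow> smooth_on (\<lambda>x. f x / c) S"
  by (simp add: divide_inverse smooth_on_mult)

lemma smooth_on_power:
  fixes f :: "'a::real_normed_vector \<Rightarrow> real"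
  shows "open S \<Longrightarrow> smooth_on f S \<Longrightarrow> smooth_on (\<lambda>x. f x ^ n) S"
  by (induction n) (auto intro: smooth_on_mult)

lemma smooth_on_sum:
  fixes f :: "'i \<Rightarrow> 'a::real_normed_vector \<Rightarrow> real"
  assumes "open S" "\<And>i. i \<in> I \<Longrightarrow> smooth_on (f i) S"
  shows "smooth_on (\<lambda>x. \<Sum>i\<in>I. f i x) S"
  using assms(2)
  by (induction I rule: infinite_finite_induct) (auto intro: smooth_on_add[OF assms(1)])

lemma smooth_on_prod:
  fixes f :: "'i \<Rightarrow> 'a::real_normed_vector \<Rightarrow> real"
  assumes "open S" "\<And>i. i \<in> I \<Longrightarrow> smooth_on (f i) S"
  shows "smooth_on (\<lambda>x. \<Prod>i\<in>I. f i x) S"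
  using assms(2)
  by (induction I rule: infinite_finite_induct) (auto intro: smooth_on_mult[OF assms(1)])

lemma smooth_on_imp_differentiable: "smooth_on f S \<Longrightarrow> x \<in> S \<Longrightarrow> f differentiable (at x)"
  unfolding smooth_on_def by (metis Ck_on.simps(2))

lemma smooth_on_imp_continuous: "smooth_on f S \<Longrightarrow> continuous_on S f"
  unfolding smooth_on_def by (metis Ck_on.simps(1))

lemma smooth_on_frechet_derivative:
  "smooth_on f S \<Longrightarrow> smooth_on (\<lambda>x. frechet_derivative f (at x) v) S"
  unfolding smooth_on_def by (metis Ck_on.simps(2))

section \<open>Symmetry of mixed second derivatives\<close>

lemma smooth_on_has_field_derivative_line:
  fixes f :: "'a::real_normed_vector \<Rightarrow> real"
  assumes "smooth_on f S" "x + t *\<^sub>R v \<in> S"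
  shows "((\<lambda>s. f (x + s *\<^sub>R v)) has_field_derivative frechet_derivative f (at (x + t *\<^sub>R v)) v) (at t)"
proof -
  let ?D = "frechet_derivative f (at (x + t *\<^sub>R v))"
  have D: "(f has_derivative ?D) (at (x + t *\<^sub>R v))"
    using smooth_on_imp_differentiable[OF assms] by (simp add: frechet_derivative_works)
  have "((\<lambda>s. x + s *\<^sub>R v) has_derivative (\<lambda>s. s *\<^sub>R v)) (at t)"
    by (auto intro!: derivative_eq_intros)
  then have "((\<lambda>s. f (x + s *\<^sub>R v)) has_derivative (\<lambda>s. ?D (s *\<^sub>R v))) (at t)"
    using has_derivative_compose D by fastforce
  moreover have "?D (s *\<^sub>R v) = ?D v * s" for s
    using has_derivative_linear[OF D] by (simp add: linear_scale mult.commute)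
  ultimately show ?thesis by (simp add: has_field_derivative_def)
qed

text \<open>The mean value theorem is used twice: along \<open>u\<close> for the difference of
  \<open>f\<close> between two parallel edges, then along \<open>v\<close> for the derivative of
  \<open>f\<close> in direction \<open>u\<close>.\<close>

lemma second_difference_mvt:
  fixes f :: "'a::real_normed_vector \<Rightarrow> real"
  assumes "smooth_on f S" "h > 0"
    and S: "\<And>s t. 0 \<le> s \<Longrightarrow> s \<le> h \<Longrightarrow> 0 \<le> t \<Longrightarrow> t \<le> h \<Longrightarrow> z + s *\<^sub>R u + t *\<^sub>R v \<in> S"
  obtains s t where "0 \<le> s" "s \<le> h" "0 \<le> t" "t \<le> h"
    "f (z + h *\<^sub>R u + h *\<^sub>R v) - f (z + h *\<^sub>R u) - f (z + h *\<^sub>R v) + f z =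
     h * h * frechet_derivative (\<lambda>x. frechet_derivative f (at x) u) (at (z + s *\<^sub>R u + t *\<^sub>R v)) v"
proof -
  define Du where "Du = (\<lambda>x. frechet_derivative f (at x) u)"
  have Du: "smooth_on Du S" unfolding Du_def using assms(1) by (rule smooth_on_frechet_derivative)
  have eq: "z + s *\<^sub>R u + t *\<^sub>R v = (z + t *\<^sub>R v) + s *\<^sub>R u" for s t by simp
  let ?g = "\<lambda>s. f ((z + h *\<^sub>R v) + s *\<^sub>R u) - f (z + s *\<^sub>R u)"
  have "\<exists>s. s > 0 \<and> s < h \<and> ?g h - ?g 0 = (h - 0) * (Du ((z + h *\<^sub>R v) + s *\<^sub>R u) - Du (z + s *\<^sub>R u))"
  proof (rule MVT2)
    show "0 < h" by fact
    fix s :: real assume s: "0 \<le> s" "s \<le> h"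
    have "(z + h *\<^sub>R v) + s *\<^sub>R u \<in> S" "z + s *\<^sub>R u \<in> S"
      using S[of s h] S[of s 0] s assms(2) eq[of s h] by auto
    then show "DERIV ?g s :> Du ((z + h *\<^sub>R v) + s *\<^sub>R u) - Du (z + s *\<^sub>R u)"
      unfolding Du_def by (intro DERIV_diff smooth_on_has_field_derivative_line[OF assms(1)])
  qed
  then obtain s where s: "0 < s" "s < h"
    "?g h - ?g 0 = h * (Du ((z + h *\<^sub>R v) + s *\<^sub>R u) - Du (z + s *\<^sub>R u))" by auto
  have "\<exists>t. t > 0 \<and> t < h \<and> Du ((z + s *\<^sub>R u) + h *\<^sub>R v) - Du ((z + s *\<^sub>R u) + 0 *\<^sub>R v)
      = (h - 0) * frechet_derivative Du (at ((z + s *\<^sub>R u) + t *\<^sub>R v)) v"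
  proof (rule MVT2)
    show "0 < h" by fact
    fix t :: real assume t: "0 \<le> t" "t \<le> h"
    then show "DERIV (\<lambda>t. Du ((z + s *\<^sub>R u) + t *\<^sub>R v)) t :>
        frechet_derivative Du (at ((z + s *\<^sub>R u) + t *\<^sub>R v)) v"
      using S[of s t] s by (intro smooth_on_has_field_derivative_line[OF Du]) auto
  qed
  then obtain t where t: "0 < t" "t < h"
    "Du ((z + s *\<^sub>R u) + h *\<^sub>R v) - Du (z + s *\<^sub>R u)
      = h * frechet_derivative Du (at ((z + s *\<^sub>R u) + t *\<^sub>R v)) v" by auto
  have "f (z + h *\<^sub>R u + h *\<^sub>R v) - f (z + h *\<^sub>R u) - f (z + h *\<^sub>R v) + f z = ?g h - ?g 0"
    by (simp add: add_ac)
  also have "\<dots> = h * (Du ((z + s *\<^sub>R u) + h *\<^sub>R v) - Du (z + s *\<^sub>R u))"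
    using s(3) unfolding eq[of s h] .
  finally show ?thesis
    using that[of s t] s(1,2) t unfolding Du_def by simp
qed

text \<open>The second difference over a small parallelogram does not change when \<open>u\<close>
  and \<open>v\<close> are exchanged, so the two mixed derivatives agree at two intermediate points.
  By continuity each lies within \<open>e\<close>, half the supposed gap, of its value at
  \<open>z\<close>.\<close>

lemma smooth_on_frechet_derivative_commute:
  fixes f :: "'a::real_normed_vector \<Rightarrow> real"
  assumes "open S" "smooth_on f S" "z \<in> S"
  shows "frechet_derivative (\<lambda>x. frechet_derivative f (at x) u) (at z) v
       = frechet_derivative (\<lambda>x. frechet_derivative f (at x) v) (at z) u" (is "?A u v z = ?A v u z")
proof (rule ccontr)
  assume neq: "?A u v z \<noteq> ?A v u z"
  define e where "e = \<bar>?A u v z - ?A v u z\<bar> / 2"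
  have e: "e > 0" using neq by (simp add: e_def)
  have "continuous_on S (?A p q)" for p q
    using assms(2) by (intro smooth_on_imp_continuous smooth_on_frechet_derivative)
  then have "continuous (at z) (?A p q)" for p q
    using assms(1,3) continuous_on_eq_continuous_at by blast
  then have "\<exists>d>0. \<forall>x. dist x z < d \<longrightarrow> dist (?A p q x) (?A p q z) < e" for p q
    using e unfolding continuous_at_eps_delta by blast
  then obtain d where d: "\<And>p q. d p q > 0"
      "\<And>p q x. dist x z < d p q \<Longrightarrow> dist (?A p q x) (?A p q z) < e"
    by metis
  obtain r where r: "r > 0" "ball z r \<subseteq> S" using assms(1,3) open_contains_ball by blast
  define m where "m = min r (min (d u v) (d v u))"
  \<comment> \<open>The summand 1 keeps the denominator positive for \<open>u = v = 0\<close>; the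
    factor 2 keeps the parallelogram strictly within distance \<open>m\<close>.\<close>
  define h where "h = m / (2 * (norm u + norm v + 1))"
  have m: "m > 0" using r d by (simp add: m_def)
  then have h: "h > 0" by (simp add: h_def add_nonneg_pos)
  have small: "dist (z + s *\<^sub>R u + t *\<^sub>R v) z < m" if "0 \<le> s" "s \<le> h" "0 \<le> t" "t \<le> h" for s t
  proof -
    have "dist (z + s *\<^sub>R u + t *\<^sub>R v) z = norm (s *\<^sub>R u + t *\<^sub>R v)" by (simp add: dist_norm add.assoc)
    also have "\<dots> \<le> s * norm u + t * norm v" using that
        by (metis abs_of_nonneg norm_scaleR norm_triangle_ineq)
    also have "\<dots> \<le> h * norm u + h * norm v" using that by (intro add_mono mult_right_mono) auto
    also have "\<dots> \<le> h * (norm u + norm v + 1)" using h by (simp add: algebra_simps)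
    also have "\<dots> = m / 2"
    proof -
      have "norm u + norm v + 1 > 0" by (simp add: add_nonneg_pos)
      then show ?thesis unfolding h_def by (simp add: field_simps)
    qed
    finally show ?thesis using m by simp
  qed
  have S1: "z + s *\<^sub>R u + t *\<^sub>R v \<in> S" if "0 \<le> s" "s \<le> h" "0 \<le> t" "t \<le> h" for s t
  proof -
    have "dist z (z + s *\<^sub>R u + t *\<^sub>R v) < r" using small[OF that]
        by (subst dist_commute) (simp add: m_def)
    then show ?thesis using r(2) by (auto simp only: mem_ball subset_iff)
  qed
  have S2: "z + s *\<^sub>R v + t *\<^sub>R u \<in> S" if "0 \<le> s" "s \<le> h" "0 \<le> t" "t \<le> h" for s t
    using S1[OF that(3,4,1,2)] by (metis add.assoc add.commute)
  obtain s t where 1: "0 \<le> s" "s \<le> h" "0 \<le> t" "t \<le> h"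
    "f (z + h *\<^sub>R u + h *\<^sub>R v) - f (z + h *\<^sub>R u) - f (z + h *\<^sub>R v) + f z = h * h * ?A u v (z
        + s *\<^sub>R u + t *\<^sub>R v)"
    by (rule second_difference_mvt[OF assms(2) h S1])
  obtain s' t' where 2: "0 \<le> s'" "s' \<le> h" "0 \<le> t'" "t' \<le> h"
    "f (z + h *\<^sub>R v + h *\<^sub>R u) - f (z + h *\<^sub>R v) - f (z + h *\<^sub>R u) + f z = h * h * ?A v u (z
        + s' *\<^sub>R v + t' *\<^sub>R u)"
    by (rule second_difference_mvt[OF assms(2) h S2])
  have "h * h * ?A u v (z + s *\<^sub>R u + t *\<^sub>R v) = h * h * ?A v u (z + s' *\<^sub>R v + t' *\<^sub>R u)"
  proof -
    have "z + h *\<^sub>R u + h *\<^sub>R v = z + h *\<^sub>R v + h *\<^sub>R u" by simp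
    then have "f (z + h *\<^sub>R u + h *\<^sub>R v) = f (z + h *\<^sub>R v + h *\<^sub>R u)" by (rule arg_cong)
    then show ?thesis using 1(5) 2(5) by linarith
  qed
  then have "?A u v (z + s *\<^sub>R u + t *\<^sub>R v) = ?A v u (z + s' *\<^sub>R v + t' *\<^sub>R u)" using h by simp
  moreover have "dist (?A u v (z + s *\<^sub>R u + t *\<^sub>R v)) (?A u v z) < e"
    using small[OF 1(1-4)] by (intro d) (simp add: m_def)
  moreover have "dist (?A v u (z + s' *\<^sub>R v + t' *\<^sub>R u)) (?A v u z) < e"
  proof (rule d(2))
    have "z + s' *\<^sub>R v + t' *\<^sub>R u = z + t' *\<^sub>R u + s' *\<^sub>R v" by simp
    then have "dist (z + s' *\<^sub>R v + t' *\<^sub>R u) z < m" using small[OF 2(3,4,1,2)] by (simp only:)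
    then show "dist (z + s' *\<^sub>R v + t' *\<^sub>R u) z < d v u" by (simp add: m_def)
  qed
  ultimately show False
    using dist_triangle3[of "?A u v z" "?A v u z" "?A u v (z + s *\<^sub>R u + t *\<^sub>R v)"]
    unfolding e_def dist_real_def[of "?A u v z", symmetric] by simp
qed

section \<open>Partial derivatives on the tangent bundle\<close>

text \<open>Common form of \<open>Dx\<close> and \<open>Dy\<close>: the calculus is proved once and
  specialised by folding.\<close>

definition dir_deriv :: "'a::real_normed_vector \<Rightarrow> ('a \<Rightarrow> real) \<Rightarrow> 'a \<Rightarrow> real"
  where "dir_deriv v f z = deriv (\<lambda>t. f (z + t *\<^sub>R v)) 0"

lemma Dx_eq_dir_deriv: "Dx i = dir_deriv (axis i 1, 0)"
  and Dy_eq_dir_deriv: "Dy i = dir_deriv (0, axis i 1)"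
  by (auto simp: fun_eq_iff Dx_def Dy_def dir_deriv_def)

lemma dir_deriv_eq_frechet:
  assumes "smooth_on f S" "z \<in> S"
  shows "dir_deriv v f z = frechet_derivative f (at z) v"
  using smooth_on_has_field_derivative_line[OF assms(1), of z 0 v] assms(2)
  by (simp add: dir_deriv_def DERIV_imp_deriv)

text \<open>\<open>deriv\<close> looks only at nearby points of a line, and openness keeps them in
  \<open>S\<close>. This is what allows an identity valid only on \<open>S\<close> to be
  differentiated.\<close>

lemma dir_deriv_cong:
  assumes "open S" "\<And>w. w \<in> S \<Longrightarrow> f w = g w" "z \<in> S"
  shows "dir_deriv v f z = dir_deriv v g z"
proof -
  have "open ((\<lambda>t. z + t *\<^sub>R v) -` S)"
    by (intro open_vimage assms(1) continuous_intros)
  then have "\<forall>\<^sub>F t in nhds 0. t \<in> (\<lambda>t. z + t *\<^sub>R v) -` S"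
    using assms(3) by (intro eventually_nhds_in_open) auto
  then have "\<forall>\<^sub>F t in nhds 0. f (z + t *\<^sub>R v) = g (z + t *\<^sub>R v)"
    by (rule eventually_mono) (simp add: assms(2))
  then show ?thesis unfolding dir_deriv_def by (rule deriv_cong_ev) simp
qed

locale open_set =
  fixes S :: "'a::real_normed_vector set"
  assumes open_S [simp]: "open S"
begin

lemma smooth_dir_deriv: "smooth_on f S \<Longrightarrow> smooth_on (dir_deriv v f) S"
  by (rule smooth_on_cong[OF open_S _ smooth_on_frechet_derivative[of f S v]])
    (auto simp: dir_deriv_eq_frechet)

lemma dir_deriv_commute:
  assumes "smooth_on f S" "z \<in> S"
  shows "dir_deriv u (dir_deriv v f) z = dir_deriv v (dir_deriv u f) z"
proof -
  have "dir_deriv u (dir_deriv v f) z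
      = frechet_derivative (\<lambda>x. frechet_derivative f (at x) v) (at z) u" for u v
  proof -
    have "dir_deriv u (dir_deriv v f) z = dir_deriv u (\<lambda>x. frechet_derivative f (at x) v) z"
      by (rule dir_deriv_cong[OF open_S _ assms(2)]) (simp add: dir_deriv_eq_frechet[OF assms(1)])
    then show ?thesis
      using dir_deriv_eq_frechet[OF smooth_on_frechet_derivative[OF assms(1)] assms(2)] by simp
  qed
  then show ?thesis using smooth_on_frechet_derivative_commute[OF open_S assms] by simp
qed

lemma has_field_derivative_dir_deriv:
  assumes "smooth_on f S" "z \<in> S"
  shows "((\<lambda>t. f (z + t *\<^sub>R v)) has_field_derivative dir_deriv v f z) (at 0)"
  using smooth_on_has_field_derivative_line[OF assms(1), of z 0 v] assms(2)
  by (simp add: dir_deriv_eq_frechet[OF assms])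

lemma dir_deriv_add:
  assumes "smooth_on f S" "smooth_on g S" "z \<in> S"
  shows "dir_deriv v (\<lambda>x. f x + g x) z = dir_deriv v f z + dir_deriv v g z"
  unfolding dir_deriv_def[of v "\<lambda>x. f x + g x"]
  using assms by (intro DERIV_imp_deriv DERIV_add has_field_derivative_dir_deriv)

lemma dir_deriv_diff:
  assumes "smooth_on f S" "smooth_on g S" "z \<in> S"
  shows "dir_deriv v (\<lambda>x. f x - g x) z = dir_deriv v f z - dir_deriv v g z"
  unfolding dir_deriv_def[of v "\<lambda>x. f x - g x"]
  using assms by (intro DERIV_imp_deriv DERIV_diff has_field_derivative_dir_deriv)

lemma dir_deriv_mult:
  assumes "smooth_on f S" "smooth_on g S" "z \<in> S"
  shows "dir_deriv v (\<lambda>x. f x * g x) z = dir_deriv v f z * g z + f z * dir_deriv v g z"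
  unfolding dir_deriv_def[of v "\<lambda>x. f x * g x"]
  using DERIV_mult[OF has_field_derivative_dir_deriv[OF assms(1,3)]
      has_field_derivative_dir_deriv[OF assms(2,3)], of v v]
  by (intro DERIV_imp_deriv) (simp add: mult.commute)

lemma dir_deriv_divide_const:
  assumes "smooth_on f S" "z \<in> S"
  shows "dir_deriv v (\<lambda>x. f x / c) z = dir_deriv v f z / c"
  unfolding dir_deriv_def[of v "\<lambda>x. f x / c"]
  using assms by (intro DERIV_imp_deriv DERIV_cdivide has_field_derivative_dir_deriv)

lemma dir_deriv_const [simp]: "dir_deriv v (\<lambda>x. c) z = 0"
  by (simp add: dir_deriv_def)

lemma dir_deriv_sum:
  assumes "\<And>i. i \<in> I \<Longrightarrow> smooth_on (f i) S" "z \<in> S"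
  shows "dir_deriv v (\<lambda>x. \<Sum>i\<in>I. f i x) z = (\<Sum>i\<in>I. dir_deriv v (f i) z)"
  unfolding dir_deriv_def[of v "\<lambda>x. \<Sum>i\<in>I. f i x"]
  using assms by (intro DERIV_imp_deriv DERIV_sum has_field_derivative_dir_deriv)

end

locale phase_space = open_set S for S :: "((real^'n::finite) \<times> (real^'n)) set"
begin

lemmas smooth_Dx [simp] = smooth_dir_deriv[of _ "(axis i 1, 0)" for i, folded Dx_eq_dir_deriv]
lemmas smooth_Dy [simp] = smooth_dir_deriv[of _ "(0, axis i 1)" for i, folded Dy_eq_dir_deriv]
lemmas smooth_arith [simp] = smooth_on_add[OF open_S] smooth_on_diff[OF open_S]
  smooth_on_mult[OF open_S] smooth_on_minus[OF open_S] smooth_on_sum[OF open_S]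
  smooth_on_power[OF open_S] smooth_on_divide_const[OF open_S]

lemma smooth_snd [simp]: "smooth_on (\<lambda>z. snd z $ i) S"
  by (rule smooth_on_bounded_linear)
    (intro bounded_linear_compose[OF bounded_linear_vec_nth bounded_linear_snd])

lemmas Dx_cong = dir_deriv_cong[OF open_S, of _ _ _ "(axis i 1, 0)" for i, folded Dx_eq_dir_deriv]
lemmas Dy_cong = dir_deriv_cong[OF open_S, of _ _ _ "(0, axis i 1)" for i, folded Dy_eq_dir_deriv]

lemmas Dx_add = dir_deriv_add[of _ _ _ "(axis i 1, 0)" for i, folded Dx_eq_dir_deriv]
lemmas Dx_diff = dir_deriv_diff[of _ _ _ "(axis i 1, 0)" for i, folded Dx_eq_dir_deriv]
lemmas Dx_divide_const = dir_deriv_divide_const[of _ _ "(axis i 1, 0)" for i, folded Dx_eq_dir_deriv]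
lemmas Dx_mult = dir_deriv_mult[of _ _ _ "(axis i 1, 0)" for i, folded Dx_eq_dir_deriv]
lemmas Dx_const [simp] = dir_deriv_const[of "(axis i 1, 0) :: (real^'n) \<times> (real^'n)" for i,
    folded Dx_eq_dir_deriv]
lemmas Dx_sum = dir_deriv_sum[of _ _ _ "(axis i 1, 0)" for i, folded Dx_eq_dir_deriv]

lemmas Dy_add = dir_deriv_add[of _ _ _ "(0, axis i 1)" for i, folded Dy_eq_dir_deriv]
lemmas Dy_diff = dir_deriv_diff[of _ _ _ "(0, axis i 1)" for i, folded Dy_eq_dir_deriv]
lemmas Dy_divide_const = dir_deriv_divide_const[of _ _ "(0, axis i 1)" for i, folded Dy_eq_dir_deriv]
lemmas Dy_mult = dir_deriv_mult[of _ _ _ "(0, axis i 1)" for i, folded Dy_eq_dir_deriv]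
lemmas Dy_const [simp] = dir_deriv_const[of "(0, axis i 1) :: (real^'n) \<times> (real^'n)" for i,
    folded Dy_eq_dir_deriv]
lemmas Dy_sum = dir_deriv_sum[of _ _ _ "(0, axis i 1)" for i, folded Dy_eq_dir_deriv]

lemmas D_simps = Dx_add Dx_diff Dx_mult Dx_sum Dx_divide_const Dy_add Dy_diff Dy_mult Dy_sum Dy_divide_const

lemma Dx_snd [simp]:
  fixes i j :: "'k::finite"
  shows "Dx i (\<lambda>z. snd z $ j) z = 0"
  by (cases z) (simp add: Dx_def)

lemma Dy_snd [simp]:
  fixes i j :: "'k::finite"
  shows "Dy i (\<lambda>z. snd z $ j) z = (if i = j then 1 else 0)"
proof -
  have "((\<lambda>t. snd z $ j + t * axis i 1 $ j) has_field_derivative axis i 1 $ j) (at 0)"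
      for z :: "(real^'k) \<times> (real^'k)"
    by (auto intro!: derivative_eq_intros)
  then show ?thesis
    by (cases z) (auto simp: Dy_def axis_def intro!: DERIV_imp_deriv)
qed

lemma Dx_Dx: "smooth_on f S \<Longrightarrow> z \<in> S \<Longrightarrow> Dx i (Dx j f) z = Dx j (Dx i f) z"
  and Dy_Dy: "smooth_on f S \<Longrightarrow> z \<in> S \<Longrightarrow> Dy i (Dy j f) z = Dy j (Dy i f) z"
  and Dx_Dy: "smooth_on f S \<Longrightarrow> z \<in> S \<Longrightarrow> Dx i (Dy j f) z = Dy j (Dx i f) z"
  by (simp_all only: Dx_eq_dir_deriv Dy_eq_dir_deriv dir_deriv_commute)

end

lemma sum_delta_mult [simp]:
  fixes f :: "'n::finite \<Rightarrow> real"
  shows "(\<Sum>m\<in>UNIV. (if m = k then 1 else 0) * f m) = f k"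
    and "(\<Sum>m\<in>UNIV. (if k = m then 1 else 0) * f m) = f k"
    and "(\<Sum>m\<in>UNIV. f m * (if m = k then 1 else 0)) = f k"
    and "(\<Sum>m\<in>UNIV. f m * (if k = m then 1 else 0)) = f k"
  by (simp_all add: if_distrib[where f="\<lambda>x. x * _"] if_distrib[where f="\<lambda>x. _ * x"] cong: if_cong)

section \<open>The curvature of a spray\<close>

text \<open>Homogeneity of degree two is stated as Euler's identity, which makes sense on any open
  \<open>S\<close>.\<close>

locale spray = phase_space S for S :: "((real^'n::finite) \<times> (real^'n)) set" +
  fixes G :: "'n \<Rightarrow> (real^'n) \<times> (real^'n) \<Rightarrow> real"
  assumes smooth_G [simp]: "smooth_on (G i) S"
    and euler_G: "z \<in> S \<Longrightarrow> (\<Sum>j\<in>UNIV. snd z $ j * Dy j (G i) z) = 2 * G i z"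
begin

abbreviation N :: "'n \<Rightarrow> 'n \<Rightarrow> (real^'n) \<times> (real^'n) \<Rightarrow> real"
  where "N i j \<equiv> Dy j (G i)"

abbreviation \<Gamma> :: "'n \<Rightarrow> 'n \<Rightarrow> 'n \<Rightarrow> (real^'n) \<times> (real^'n) \<Rightarrow> real"
  where "\<Gamma> i j k \<equiv> Dy k (Dy j (G i))"

text \<open>The horizontal frame vector acting on functions. Tensor components are treated as plain
  functions, and connection terms with \<open>\<Gamma>\<close> are written out where they
  occur.\<close>

definition hder :: "'n \<Rightarrow> ((real^'n) \<times> (real^'n) \<Rightarrow> real) \<Rightarrow> (real^'n) \<times> (real^'n) \<Rightarrow> real"
  where "hder j f = (\<lambda>z. Dx j f z - (\<Sum>m\<in>UNIV. N m j z * Dy m f z))"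

definition curv :: "'n \<Rightarrow> 'n \<Rightarrow> 'n \<Rightarrow> (real^'n) \<times> (real^'n) \<Rightarrow> real"
  where "curv i k l = (\<lambda>z. hder k (N i l) z - hder l (N i k) z)"

lemma smooth_hder [simp]: "smooth_on f S \<Longrightarrow> smooth_on (hder j f) S"
  by (simp add: hder_def)

lemma smooth_curv [simp]: "smooth_on (curv i k l) S"
  by (simp add: curv_def)

lemma \<Gamma>_sym: "z \<in> S \<Longrightarrow> \<Gamma> i j k z = \<Gamma> i k j z"
  by (simp add: Dy_Dy)

lemma curv_antisym: "curv i k l z = - curv i l k z"
  by (simp add: curv_def)

lemma hder_cong:
  assumes "\<And>w. w \<in> S \<Longrightarrow> f w = g w" "z \<in> S"
  shows "hder j f z = hder j g z"
  unfolding hder_def using Dx_cong[of f g z] Dy_cong[of f g z] assms by simp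

lemma hder_add: "smooth_on f S \<Longrightarrow> smooth_on g S \<Longrightarrow> z \<in> S \<Longrightarrow>
    hder j (\<lambda>z. f z + g z) z = hder j f z + hder j g z"
  by (simp add: hder_def D_simps sum.distrib algebra_simps)

lemma hder_diff: "smooth_on f S \<Longrightarrow> smooth_on g S \<Longrightarrow> z \<in> S \<Longrightarrow>
    hder j (\<lambda>z. f z - g z) z = hder j f z - hder j g z"
  by (simp add: hder_def D_simps sum_subtractf algebra_simps)

lemma hder_mult: "smooth_on f S \<Longrightarrow> smooth_on g S \<Longrightarrow> z \<in> S \<Longrightarrow>
    hder j (\<lambda>z. f z * g z) z = hder j f z * g z + f z * hder j g z"
  by (simp add: hder_def D_simps sum.distrib sum_distrib_left sum_distrib_right algebra_simps)

lemma hder_divide_const: "smooth_on f S \<Longrightarrow> z \<in> S \<Longrightarrow>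
    hder j (\<lambda>z. f z / c) z = hder j f z / c"
  by (simp add: hder_def D_simps sum_divide_distrib diff_divide_distrib)

lemma hder_const [simp]: "hder j (\<lambda>z. c) z = 0"
  by (simp add: hder_def)

lemma hder_sum:
  assumes "\<And>i. i \<in> I \<Longrightarrow> smooth_on (f i) S" "z \<in> S"
  shows "hder j (\<lambda>z. \<Sum>i\<in>I. f i z) z = (\<Sum>i\<in>I. hder j (f i) z)"
  using assms
  by (simp add: hder_def D_simps sum_subtractf sum_distrib_left sum.swap[of _ I])

lemma hder_snd [simp]: "hder j (\<lambda>z. snd z $ i) z = - N i j z"
  by (simp add: hder_def)

lemmas hder_simps = hder_add hder_diff hder_mult hder_sum hder_divide_const

text \<open>\<open>Dy k\<close> also hits the coefficients \<open>N m j\<close>, which gives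
  \<open>\<Gamma> m j k\<close>. Read backwards, the Berwald derivative of a vertical gradient is
  the vertical gradient of a horizontal derivative.\<close>

lemma Dy_hder:
  assumes "smooth_on f S" "z \<in> S"
  shows "Dy k (hder j f) z = hder j (Dy k f) z - (\<Sum>m\<in>UNIV. \<Gamma> m j k z * Dy m f z)"
proof -
  have "Dy k (hder j f) z = Dy k (Dx j f) z - (\<Sum>m\<in>UNIV. \<Gamma> m j k z * Dy m f z
      + N m j z * Dy k (Dy m f) z)"
    using assms by (simp add: hder_def D_simps)
  then show ?thesis
    using assms by (simp add: hder_def sum.distrib Dx_Dy Dy_Dy[of f z k])
qed

text \<open>All terms with second derivatives of \<open>f\<close> are symmetric in \<open>k\<close>
  and \<open>l\<close> (\<open>Q\<close> is the purely vertical part). Only the derivatives of the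
  coefficients \<open>N\<close> survive the commutator.\<close>

lemma hder_commute:
  assumes f: "smooth_on f S" and z: "z \<in> S"
  shows "hder k (hder l f) z - hder l (hder k f) z = - (\<Sum>m\<in>UNIV. curv m k l z * Dy m f z)"
proof -
  define Q where "Q k l = (\<Sum>m\<in>UNIV. \<Sum>p\<in>UNIV. N m l z * (N p k z * Dy p (Dy m f) z))" for k l
  have Q: "Q k l = Q l k" for k l
    unfolding Q_def by (subst sum.swap) (simp add: Dy_Dy[OF f z] mult.left_commute)
  have "hder k (hder l f) z = hder k (Dx l f) z - (\<Sum>m\<in>UNIV. hder k (N m l) z * Dy m f z
      + N m l z * hder k (Dy m f) z)" for k l
    unfolding hder_def[of l] using f z by (simp add: hder_simps)
  also have "\<dots> k l = Dx k (Dx l f) z - (\<Sum>p\<in>UNIV. N p k z * Dy p (Dx l f) z)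
      - (\<Sum>m\<in>UNIV. hder k (N m l) z * Dy m f z) - (\<Sum>m\<in>UNIV. N m l z * Dx k (Dy m f) z) + Q k l" for k l
    by (simp add: Q_def hder_def[of k "Dx l f"] hder_def[of k "Dy _ f"] sum.distrib sum_subtractf
      right_diff_distrib sum_distrib_left)
  finally have *: "hder k (hder l f) z = Dx k (Dx l f) z - (\<Sum>p\<in>UNIV. N p k z * Dy p (Dx l f) z)
      - (\<Sum>m\<in>UNIV. hder k (N m l) z * Dy m f z) - (\<Sum>m\<in>UNIV. N m l z * Dx k (Dy m f) z) + Q k l" for k l .
  show ?thesis
    unfolding * Q[of k l] curv_def using f z
    by (simp add: Dx_Dy Dx_Dx[of f z k] left_diff_distrib sum_subtractf)
qed

section \<open>Euler and Bianchi identities of the spray\<close>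

lemma euler_N:
  assumes "z \<in> S"
  shows "(\<Sum>j\<in>UNIV. snd z $ j * \<Gamma> i l j z) = N i l z"
proof -
  have "Dy l (\<lambda>z. \<Sum>j\<in>UNIV. snd z $ j * N i j z) z = Dy l (\<lambda>z. 2 * G i z) z"
    using assms by (intro Dy_cong euler_G)
  then have "N i l z + (\<Sum>j\<in>UNIV. snd z $ j * \<Gamma> i j l z) = 2 * N i l z"
    using assms by (simp add: D_simps sum.distrib)
  then show ?thesis using assms by (simp only: \<Gamma>_sym[of z _ l])
qed

lemma euler_N':
  assumes "z \<in> S"
  shows "(\<Sum>j\<in>UNIV. snd z $ j * \<Gamma> i j l z) = N i l z"
  using euler_N[OF assms, of l i] by (simp only: \<Gamma>_sym[OF assms, of _ l])

text \<open>Contracted with y^j, the \<open>\<Gamma>\<close> of \<open>Dy_hder\<close> collapses to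
  \<open>N\<close>. The lemma evaluates the spray derivative of the vertical gradients of
  \<open>F\<close> and \<open>K\<close>.\<close>

lemma hder_Dy_radial:
  assumes "smooth_on f S" "z \<in> S"
  shows "(\<Sum>j\<in>UNIV. snd z $ j * hder j (Dy l f) z) =
    (\<Sum>j\<in>UNIV. snd z $ j * Dy l (hder j f) z) + (\<Sum>m\<in>UNIV. N m l z * Dy m f z)"
proof -
  have "(\<Sum>j\<in>UNIV. snd z $ j * (\<Sum>m\<in>UNIV. \<Gamma> m j l z * Dy m f z))
      = (\<Sum>m\<in>UNIV. (\<Sum>j\<in>UNIV. snd z $ j * \<Gamma> m j l z) * Dy m f z)"
    by (simp add: sum_distrib_left sum_distrib_right mult.assoc) (rule sum.swap)
  then show ?thesis
    unfolding Dy_hder[OF assms] euler_N'[OF assms(2)]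
    by (simp add: right_diff_distrib sum_subtractf)
qed

lemma Dy_curv:
  assumes z: "z \<in> S"
  shows "Dy j (curv i k l) z = hder k (\<Gamma> i l j) z - hder l (\<Gamma> i k j) z
     - (\<Sum>m\<in>UNIV. \<Gamma> m k j z * \<Gamma> i l m z) + (\<Sum>m\<in>UNIV. \<Gamma> m l j z * \<Gamma> i k m z)"
  unfolding curv_def using z by (simp add: D_simps Dy_hder)

text \<open>The lower indices of \<open>\<Gamma>\<close> are symmetric, so the horizontal
  derivatives and the quadratic terms of \<open>Dy_curv\<close> both cancel in pairs.\<close>

lemma vertical_bianchi:
  assumes z: "z \<in> S"
  shows "Dy j (curv i k l) z + Dy k (curv i l j) z + Dy l (curv i j k) z = 0"
proof -
  have "hder p (\<Gamma> i q r) z = hder p (\<Gamma> i r q) z" for p q r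
    using z by (intro hder_cong \<Gamma>_sym)
  note h = this[of j k l] this[of k l j] this[of l j k]
  show ?thesis unfolding Dy_curv[OF z] h
    by (simp add: \<Gamma>_sym[OF z, where j=k and k=j] \<Gamma>_sym[OF z, where j=l and k=j]
        \<Gamma>_sym[OF z, where j=l and k=k])
qed

text \<open>Since d_k y^j = - N^j_k, pulling y^j through \<open>hder\<close> leaves a product of
  \<open>N\<close> and \<open>\<Gamma>\<close>; the contracted quadratic terms of
  \<open>Dy_curv\<close> remove it.\<close>

lemma euler_curv:
  assumes z: "z \<in> S"
  shows "(\<Sum>j\<in>UNIV. snd z $ j * Dy j (curv i k l) z) = curv i k l z"
proof -
  have h: "(\<Sum>j\<in>UNIV. snd z $ j * hder k (\<Gamma> i l j) z) = hder k (N i l) z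
      + (\<Sum>j\<in>UNIV. N j k z * \<Gamma> i l j z)" for k l
  proof -
    have "hder k (\<lambda>z. \<Sum>j\<in>UNIV. snd z $ j * \<Gamma> i l j z) z = hder k (N i l) z"
      using z by (intro hder_cong euler_N)
    then show ?thesis using z by (simp add: hder_simps sum.distrib sum_subtractf)
  qed
  have g: "(\<Sum>j\<in>UNIV. snd z $ j * (\<Sum>m\<in>UNIV. \<Gamma> m k j z * \<Gamma> i l m z))
      = (\<Sum>m\<in>UNIV. N m k z * \<Gamma> i l m z)" for k l
  proof -
    have "(\<Sum>j\<in>UNIV. snd z $ j * (\<Sum>m\<in>UNIV. \<Gamma> m k j z * \<Gamma> i l m z))
        = (\<Sum>m\<in>UNIV. (\<Sum>j\<in>UNIV. snd z $ j * \<Gamma> m k j z) * \<Gamma> i l m z)"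
      by (simp add: sum_distrib_left sum_distrib_right mult.assoc) (rule sum.swap)
    then show ?thesis by (simp add: euler_N[OF z])
  qed
  show ?thesis
    unfolding Dy_curv[OF z]
    by (simp add: right_diff_distrib distrib_left sum.distrib sum_subtractf h g) (simp add: curv_def)
qed

text \<open>The right-hand side is the coordinate formula for \<open>R^i_k\<close>: this fixes the sign of \<open>curv\<close>.\<close>

lemma curv_contract_last:
  assumes z: "z \<in> S"
  shows "(\<Sum>l\<in>UNIV. curv i k l z * snd z $ l) =
    2 * Dx k (G i) z - (\<Sum>l\<in>UNIV. Dy k (Dx l (G i)) z * snd z $ l)
    + 2 * (\<Sum>l\<in>UNIV. G l z * Dy k (Dy l (G i)) z) - (\<Sum>l\<in>UNIV. N i l z * N l k z)"
proof -
  have 1: "(\<Sum>l\<in>UNIV. hder k (N i l) z * snd z $ l) = 2 * hder k (G i) z + (\<Sum>l\<in>UNIV. N i l z * N l k z)"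
  proof -
    have "hder k (\<lambda>z. \<Sum>l\<in>UNIV. snd z $ l * N i l z) z = hder k (\<lambda>z. 2 * G i z) z"
      using z by (intro hder_cong euler_G)
    then show ?thesis using z by (simp add: hder_simps sum.distrib sum_subtractf mult.commute)
  qed
  have "(\<Sum>l\<in>UNIV. (\<Sum>m\<in>UNIV. N m l z * Dy m (N i k) z) * snd z $ l)
      = (\<Sum>m\<in>UNIV. (\<Sum>l\<in>UNIV. snd z $ l * N m l z) * Dy m (N i k) z)"
    by (simp add: sum_distrib_left sum_distrib_right mult_ac) (rule sum.swap)
  also have "\<dots> = 2 * (\<Sum>l\<in>UNIV. G l z * Dy k (Dy l (G i)) z)"
    by (simp add: euler_G[OF z] sum_distrib_left \<Gamma>_sym[OF z, where j=k] mult.assoc)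
  finally have 2: "(\<Sum>l\<in>UNIV. hder l (N i k) z * snd z $ l) = (\<Sum>l\<in>UNIV. Dy k (Dx l (G i)) z * snd z $ l)
     - 2 * (\<Sum>l\<in>UNIV. G l z * Dy k (Dy l (G i)) z)"
    using z by (simp add: hder_def left_diff_distrib sum_subtractf Dx_Dy)
  show ?thesis
    unfolding curv_def left_diff_distrib sum_subtractf 1 2
    by (simp add: hder_def mult.commute)
qed

text \<open>The two-index curvature R^i_k. Building it from \<open>curv\<close> puts its
  y-derivatives under the Euler and Bianchi identities; \<open>curv_contract_last\<close> is the
  link to the coordinate formula.\<close>

definition jacobi :: "'n \<Rightarrow> 'n \<Rightarrow> (real^'n) \<times> (real^'n) \<Rightarrow> real"
  where "jacobi i k = (\<lambda>z. \<Sum>l\<in>UNIV. curv i k l z * snd z $ l)"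

lemma smooth_jacobi [simp]: "smooth_on (jacobi i k) S"
  by (simp add: jacobi_def)

text \<open>Three copies of \<open>curv i k l\<close> appear: the product rule gives one for each
  order of \<open>k\<close> and \<open>l\<close>, by antisymmetry, and the vertical Bianchi identity
  with \<open>euler_curv\<close> turns the remaining difference into the third.\<close>

lemma curv_eq_Dy_jacobi:
  assumes z: "z \<in> S"
  shows "3 * curv i k l z = Dy l (jacobi i k) z - Dy k (jacobi i l) z"
proof -
  have D: "Dy l (jacobi i k) z = (\<Sum>j\<in>UNIV. snd z $ j * Dy l (curv i k j) z) + curv i k l z" for k l
    using z by (simp add: jacobi_def D_simps sum.distrib mult.commute)
  have "Dy l (curv i k j) z = Dy k (curv i l j) z + Dy j (curv i k l) z" for j
  proof -
    have "curv i k j = (\<lambda>z. - curv i j k z)" "curv i l k = (\<lambda>z. - curv i k l z)" for j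
      using curv_antisym by blast+
    moreover have "Dy l (\<lambda>z. 0 - curv i j k z) z = - Dy l (curv i j k) z"
      using z by (subst Dy_diff) auto
    ultimately have "Dy l (curv i k j) z = - Dy l (curv i j k) z" by simp
    then show ?thesis using vertical_bianchi[OF z, of j i k l] by simp
  qed
  then have "(\<Sum>j\<in>UNIV. snd z $ j * Dy l (curv i k j) z)
      = (\<Sum>j\<in>UNIV. snd z $ j * Dy k (curv i l j) z) + curv i k l z"
    by (simp add: distrib_left sum.distrib euler_curv[OF z])
  then show ?thesis unfolding D using curv_antisym[of i k l z] by simp
qed

lemma euler_jacobi:
  assumes z: "z \<in> S"
  shows "(\<Sum>j\<in>UNIV. snd z $ j * Dy j (jacobi i k) z) = 2 * jacobi i k z"
proof -
  have "(\<Sum>j\<in>UNIV. snd z $ j * Dy j (jacobi i k) z) =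
     (\<Sum>j\<in>UNIV. snd z $ j * (\<Sum>l\<in>UNIV. Dy j (curv i k l) z * snd z $ l))
         + (\<Sum>j\<in>UNIV. snd z $ j * curv i k j z)"
    using z by (simp add: jacobi_def D_simps sum.distrib distrib_left)
  also have "(\<Sum>j\<in>UNIV. snd z $ j * (\<Sum>l\<in>UNIV. Dy j (curv i k l) z * snd z $ l))
     = (\<Sum>l\<in>UNIV. (\<Sum>j\<in>UNIV. snd z $ j * Dy j (curv i k l) z) * snd z $ l)"
    by (simp add: sum_distrib_left sum_distrib_right mult.assoc) (rule sum.swap)
  finally show ?thesis by (simp add: euler_curv[OF z] jacobi_def mult.commute)
qed

text \<open>The second horizontal derivatives of \<open>N\<close> group into three commutators,
  evaluated by \<open>hder_commute\<close>. In the cyclic sum of covariant derivatives the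
  connection terms of the lower indices cancel, so only those of the upper index \<open>i\<close>
  appear.\<close>

lemma horizontal_bianchi:
  assumes z: "z \<in> S"
  shows "(hder j (curv i k l) z + (\<Sum>p\<in>UNIV. \<Gamma> i j p z * curv p k l z))
       + (hder k (curv i l j) z + (\<Sum>p\<in>UNIV. \<Gamma> i k p z * curv p l j z))
       + (hder l (curv i j k) z + (\<Sum>p\<in>UNIV. \<Gamma> i l p z * curv p j k z)) = 0"
proof -
  have "hder j (curv i k l) z = hder j (hder k (N i l)) z - hder j (hder l (N i k)) z" for j k l
    unfolding curv_def using z by (simp add: hder_simps)
  then show ?thesis
    using hder_commute[of "N i l" z j k] hder_commute[of "N i j" z k l] hder_commute[of "N i k" z l j] z
    by (simp add: mult.commute)
qed

end

section \<open>Sprays of scalar flag curvature\<close>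

text \<open>\<open>K\<close> enters through the curvature equation alone. \<open>dim\<close> serves
  to divide by n - 1 in the trace and by n - 2 in the Bianchi argument.\<close>

locale scalar_spray = spray S G for S :: "((real^'n::finite) \<times> (real^'n)) set" and G +
  fixes F K :: "(real^'n) \<times> (real^'n) \<Rightarrow> real"
  assumes smooth_F [simp]: "smooth_on F S"
    and F_nonzero: "z \<in> S \<Longrightarrow> F z \<noteq> 0"
    and euler_F: "z \<in> S \<Longrightarrow> (\<Sum>j\<in>UNIV. snd z $ j * Dy j F z) = F z"
    and hder_F: "z \<in> S \<Longrightarrow> hder j F z = 0"
    and jacobi_scalar: "z \<in> S \<Longrightarrow>
      jacobi i k z = K z * ((F z)\<^sup>2 * (if i = k then 1 else 0) - F z * Dy k F z * snd z $ i)"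
    and dim: "CARD('n) \<ge> 3"
begin

lemma ricci_scalar:
  assumes z: "z \<in> S"
  shows "(\<Sum>i\<in>UNIV. jacobi i i z) = (real CARD('n) - 1) * K z * (F z)\<^sup>2"
proof -
  have "(\<Sum>i\<in>UNIV. jacobi i i z) = (\<Sum>i\<in>(UNIV::'n set). K z * (F z)\<^sup>2)
      - K z * F z * (\<Sum>i\<in>UNIV. snd z $ i * Dy i F z)"
    by (simp only: jacobi_scalar[OF z] sum_distrib_left sum_subtractf[symmetric])
       (rule sum.cong, auto simp: algebra_simps)
  then show ?thesis by (simp only: euler_F[OF z]) (simp add: power2_eq_square algebra_simps)
qed

text \<open>The trace of the curvature is smooth and \<open>F\<close> has no zero on
  \<open>S\<close>, so the trace identity exhibits \<open>K\<close> as a smooth quotient.\<close>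

lemma smooth_K [simp]: "smooth_on K S"
proof (rule smooth_on_cong[OF open_S])
  show "(\<Sum>i\<in>UNIV. jacobi i i z) * inverse ((real CARD('n) - 1) * (F z)\<^sup>2) = K z" if "z \<in> S" for z
  proof -
    have "real CARD('n) - 1 \<noteq> 0" using dim by simp
    then show ?thesis using ricci_scalar[OF that] F_nonzero[OF that] by (simp add: field_simps)
  qed
  show "smooth_on (\<lambda>z. (\<Sum>i\<in>UNIV. jacobi i i z) * inverse ((real CARD('n) - 1) * (F z)\<^sup>2)) S"
    using F_nonzero dim by (intro smooth_on_mult[OF open_S] smooth_on_inverse[OF open_S]) auto
qed

text \<open>The trace and F^2 both have degree two, which leaves degree zero for \<open>K\<close>:
  apply y^j \<open>Dy j\<close> to \<open>ricci_scalar\<close> and cancel.\<close>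

lemma euler_K:
  assumes z: "z \<in> S"
  shows "(\<Sum>j\<in>UNIV. snd z $ j * Dy j K z) = 0"
proof -
  let ?c = "real CARD('n) - 1"
  have "Dy j (\<lambda>z. \<Sum>i\<in>UNIV. jacobi i i z) z = Dy j (\<lambda>z. ?c * K z * (F z * F z)) z" for j
    using ricci_scalar z by (intro Dy_cong) (auto simp: power2_eq_square)
  then have *: "(\<Sum>i\<in>UNIV. Dy j (jacobi i i) z) = ?c * Dy j K z * (F z)\<^sup>2
      + 2 * ?c * K z * F z * Dy j F z" for j
    using z by (simp add: D_simps power2_eq_square algebra_simps)
  have "2 * (\<Sum>i\<in>UNIV. jacobi i i z) = (\<Sum>i\<in>UNIV. \<Sum>j\<in>UNIV. snd z $ j * Dy j (jacobi i i) z)"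
    by (simp add: euler_jacobi[OF z] sum_distrib_left)
  also have "\<dots> = (\<Sum>j\<in>UNIV. snd z $ j * (\<Sum>i\<in>UNIV. Dy j (jacobi i i) z))"
    by (subst sum.swap) (simp add: sum_distrib_left)
  also have "\<dots> = ?c * (F z)\<^sup>2 * (\<Sum>j\<in>UNIV. snd z $ j * Dy j K z)
      + 2 * ?c * K z * F z * (\<Sum>j\<in>UNIV. snd z $ j * Dy j F z)"
    unfolding * by (simp only: sum_distrib_left sum.distrib[symmetric])
      (rule sum.cong, auto simp: algebra_simps)
  also have "\<dots> = ?c * (F z)\<^sup>2 * (\<Sum>j\<in>UNIV. snd z $ j * Dy j K z) + 2 * (?c * K z * (F z)\<^sup>2)"
    by (simp only: euler_F[OF z]) (simp add: power2_eq_square)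
  finally have "?c * (F z)\<^sup>2 * (\<Sum>j\<in>UNIV. snd z $ j * Dy j K z) = 0"
    by (simp only: ricci_scalar[OF z])
  then show ?thesis using F_nonzero[OF z] dim by simp
qed

text \<open>\<open>a_l\<close> and \<open>b_kl\<close> of the header; the \<open>d_\<close> versions are \<open>A_lj\<close> and \<open>B_jkl\<close>.\<close>

definition curv_form :: "'n \<Rightarrow> (real^'n) \<times> (real^'n) \<Rightarrow> real"
  where "curv_form l = (\<lambda>z. 1/3 * (F z * F z) * Dy l K z + K z * F z * Dy l F z)"

definition curv_rad :: "'n \<Rightarrow> 'n \<Rightarrow> (real^'n) \<times> (real^'n) \<Rightarrow> real"
  where "curv_rad k l = (\<lambda>z. 1/3 * F z * (Dy k K z * Dy l F z - Dy l K z * Dy k F z))"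

lemma smooth_curv_form [simp]: "smooth_on (curv_form l) S"
    and smooth_curv_rad [simp]: "smooth_on (curv_rad k l) S"
  by (simp_all add: curv_form_def curv_rad_def)

text \<open>Second derivatives of \<open>F\<close> drop out by symmetry. The term K F F_.l arises
  three times, twice from F^2 and once from differentiating y^m, so the division by 3 leaves 1/3
  only before F^2 K_.l.\<close>

lemma curv_scalar:
  assumes z: "z \<in> S"
  shows "curv m k l z = (if m = k then 1 else 0) * curv_form l z
      - (if m = l then 1 else 0) * curv_form k z + snd z $ m * curv_rad k l z"
proof -
  have D: "Dy l (jacobi m k) z = Dy l (\<lambda>z. K z * (F z * F z * (if m = k then 1 else 0)
      - F z * Dy k F z * snd z $ m)) z" for k l
    using z by (intro Dy_cong) (simp_all add: jacobi_scalar power2_eq_square)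
  have "3 * curv m k l z = 3 * ((if m = k then 1 else 0) * curv_form l z
      - (if m = l then 1 else 0) * curv_form k z + snd z $ m * curv_rad k l z)"
    unfolding curv_eq_Dy_jacobi[OF z] D
    using z Dy_Dy[OF smooth_F z, of k l] by (simp add: D_simps curv_form_def curv_rad_def algebra_simps)
  then show ?thesis by simp
qed

definition d_curv_form :: "'n \<Rightarrow> 'n \<Rightarrow> (real^'n) \<times> (real^'n) \<Rightarrow> real"
  where "d_curv_form l j = (\<lambda>z. hder l (curv_form j) z - hder j (curv_form l) z)"

definition d_curv_rad :: "'n \<Rightarrow> 'n \<Rightarrow> 'n \<Rightarrow> (real^'n) \<times> (real^'n) \<Rightarrow> real"
  where "d_curv_rad j k l = (\<lambda>z. hder j (curv_rad k l) z + hder k (curv_rad l j) z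
      + hder l (curv_rad j k) z)"

text \<open>The terms \<open>N m j\<close> times \<open>curv_rad\<close> cancel: one sign comes from
  d_j y^m, the other from \<open>\<Gamma>\<close> contracted with y. The products of
  \<open>\<Gamma>\<close> and \<open>curv_form\<close> cancel in the cyclic sum.\<close>

lemma bianchi_scalar:
  assumes z: "z \<in> S"
  shows "(if m = k then 1 else 0) * d_curv_form l j z + (if m = l then 1 else 0) * d_curv_form j k z
    + (if m = j then 1 else 0) * d_curv_form k l z = snd z $ m * d_curv_rad j k l z"
proof -
  have "hder j (curv m k l) z = hder j (\<lambda>z. (if m = k then 1 else 0) * curv_form l z
      - (if m = l then 1 else 0) * curv_form k z + snd z $ m * curv_rad k l z) z" for j k l
    using z by (intro hder_cong curv_scalar)
  also have "\<dots> j k l = (if m = k then 1 else 0) * hder j (curv_form l) z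
      - (if m = l then 1 else 0) * hder j (curv_form k) z
      - N m j z * curv_rad k l z + snd z $ m * hder j (curv_rad k l) z" for j k l
    using z by (simp add: hder_simps)
  finally have H: "hder j (curv m k l) z = (if m = k then 1 else 0) * hder j (curv_form l) z
      - (if m = l then 1 else 0) * hder j (curv_form k) z
      - N m j z * curv_rad k l z + snd z $ m * hder j (curv_rad k l) z" for j k l .
  have G: "(\<Sum>p\<in>UNIV. \<Gamma> m j p z * curv p k l z) = \<Gamma> m j k z * curv_form l z
      - \<Gamma> m j l z * curv_form k z + N m j z * curv_rad k l z" for j k l
  proof -
    have "(\<Sum>p\<in>UNIV. \<Gamma> m j p z * curv p k l z) =
      (\<Sum>p\<in>UNIV. \<Gamma> m j p z * (if p = k then 1 else 0)) * curv_form l z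
      - (\<Sum>p\<in>UNIV. \<Gamma> m j p z * (if p = l then 1 else 0)) * curv_form k z
      + (\<Sum>p\<in>UNIV. snd z $ p * \<Gamma> m j p z) * curv_rad k l z"
      unfolding sum_distrib_right sum_subtractf[symmetric] sum.distrib[symmetric]
      by (rule sum.cong) (simp_all add: curv_scalar[OF z] algebra_simps)
    then show ?thesis by (simp only: sum_delta_mult euler_N[OF z])
  qed
  have "\<Gamma> m j k z = \<Gamma> m k j z" "\<Gamma> m l j z = \<Gamma> m j l z" "\<Gamma> m k l z = \<Gamma> m l k z"
    using \<Gamma>_sym[OF z] by auto
  then show ?thesis
    using horizontal_bianchi[OF z, of j m k l] unfolding H G d_curv_form_def d_curv_rad_def
        by (simp only:) (simp add: algebra_simps)
qed

lemma d_curv_form_radial: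
  assumes z: "z \<in> S"
  shows "(\<Sum>j\<in>UNIV. snd z $ j * d_curv_form l j z) = 0"
proof -
  have "(\<Sum>k\<in>UNIV. snd z $ k * d_curv_rad j k l z) = (\<Sum>k\<in>(UNIV::'n set). d_curv_form l j z)
     + (\<Sum>k\<in>UNIV. (if k = l then 1 else 0) * d_curv_form j k z) + (\<Sum>k\<in>UNIV. (if k
         = j then 1 else 0) * d_curv_form k l z)" for j
    unfolding sum.distrib[symmetric] by (rule sum.cong) (simp_all add: bianchi_scalar[OF z, symmetric])
  \<comment> \<open>The first sum contributes n; antisymmetry of \<open>d_curv_form\<close> makes
    each of the other two contribute -1.\<close>
  also have "\<dots> j = (real CARD('n) - 2) * d_curv_form l j z" for j
    by (simp only: sum_delta_mult) (simp add: d_curv_form_def algebra_simps)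
  finally have T: "(\<Sum>k\<in>UNIV. snd z $ k * d_curv_rad j k l z) = (real CARD('n)
      - 2) * d_curv_form l j z" for j .
  have anti: "d_curv_rad k j l z = - d_curv_rad j k l z" for j k
  proof -
    have "hder j (curv_rad k l) z = - hder j (curv_rad l k) z" for j k l
    proof -
      have "hder j (curv_rad k l) z = hder j (\<lambda>z. 0 - curv_rad l k z) z"
        using z by (intro hder_cong) (simp_all add: curv_rad_def algebra_simps)
      then show ?thesis using hder_diff[of "\<lambda>z. 0" "curv_rad l k" z j] z by simp
    qed
    from this[of k j l] this[of j l k] this[of l k j] show ?thesis by (simp add: d_curv_rad_def)
  qed
  \<comment> \<open>The symmetric y^j y^k meets a factor antisymmetric in \<open>j\<close> and
    \<open>k\<close>, so \<open>?X\<close> is its own negative.\<close>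
  let ?X = "\<Sum>j\<in>UNIV. \<Sum>k\<in>UNIV. snd z $ j * (snd z $ k * d_curv_rad j k l z)"
  have "?X = (\<Sum>j\<in>UNIV. \<Sum>k\<in>UNIV. snd z $ k * (snd z $ j * d_curv_rad k j l z))"
    by (rule sum.swap)
  also have "\<dots> = - ?X"
  proof -
    have "snd z $ k * (snd z $ j * d_curv_rad k j l z) =
        - (snd z $ j * (snd z $ k * d_curv_rad j k l z))" for j k
      using anti[of k j] by simp
    then show ?thesis unfolding sum_negf[symmetric] by (intro sum.cong refl)
  qed
  finally have "?X = 0" by simp
  moreover have "?X = (\<Sum>j\<in>UNIV. snd z $ j * ((real CARD('n) - 2) * d_curv_form l j z))"
    by (simp only: sum_distrib_left[symmetric] T)
  ultimately have "(real CARD('n) - 2) * (\<Sum>j\<in>UNIV. snd z $ j * d_curv_form l j z) = 0"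
    by (simp add: sum_distrib_left mult.left_commute)
  then show ?thesis using dim by simp
qed

text \<open>The derivative of \<open>K\<close> along the spray vector field, P in the
  overview.\<close>

definition K_dot :: "(real^'n) \<times> (real^'n) \<Rightarrow> real"
  where "K_dot = (\<lambda>z. \<Sum>j\<in>UNIV. snd z $ j * hder j K z)"

lemma smooth_K_dot [simp]: "smooth_on K_dot S"
  by (simp add: K_dot_def)

text \<open>Both sides of y^j d_l a_j = y^j d_j a_l are expanded, and their terms with
  \<open>N\<close> agree. The 4 is 3 + 1: after multiplication by 3 one side gives 3 F^2 d_l K, and
  commuting \<open>Dy l\<close> with the spray derivative gives one more.\<close>

lemma hder_K_eq:
  assumes z: "z \<in> S"
  shows "4 * F z * hder l K z = F z * Dy l K_dot z + 3 * K_dot z * Dy l F z"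
proof -
  have "(\<Sum>j\<in>UNIV. snd z $ j * curv_form j z) = K z * (F z * F z)" if z: "z \<in> S" for z
  proof -
    have "(\<Sum>j\<in>UNIV. snd z $ j * curv_form j z) = 1/3 * (F z * F z) * (\<Sum>j\<in>UNIV. snd z $ j * Dy j K z)
        + K z * F z * (\<Sum>j\<in>UNIV. snd z $ j * Dy j F z)"
      unfolding sum_distrib_left sum.distrib[symmetric] curv_form_def
      by (rule sum.cong) (simp_all add: algebra_simps)
    then show ?thesis by (simp add: euler_F[OF z] euler_K[OF z])
  qed
  then have "hder l (\<lambda>z. \<Sum>j\<in>UNIV. snd z $ j * curv_form j z) z = hder l (\<lambda>z. K z * (F z * F z)) z"
    using z by (intro hder_cong) auto
  then have 1: "(\<Sum>j\<in>UNIV. snd z $ j * hder l (curv_form j) z) = hder l K z * (F z * F z)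
      + (\<Sum>j\<in>UNIV. N j l z * curv_form j z)"
    using z by (simp add: hder_simps hder_F sum_subtractf sum.distrib)
  have "Dy l (hder j F) z = Dy l (\<lambda>z. 0) z" for j
    using z by (intro Dy_cong) (simp_all add: hder_F)
  then have 2: "(\<Sum>j\<in>UNIV. snd z $ j * hder j (Dy l F) z) = (\<Sum>m\<in>UNIV. N m l z * Dy m F z)"
    using hder_Dy_radial[OF smooth_F z, of l] by simp
  \<comment> \<open>\<open>Dy l\<close> also differentiates the factor y^j, which splits off
    \<open>hder l K\<close>.\<close>
  have "Dy l K_dot z = hder l K z + (\<Sum>j\<in>UNIV. snd z $ j * Dy l (hder j K) z)"
    unfolding K_dot_def using z by (simp add: D_simps sum.distrib)
  then have 3: "(\<Sum>j\<in>UNIV. snd z $ j * hder j (Dy l K) z) = Dy l K_dot z - hder l K z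
      + (\<Sum>m\<in>UNIV. N m l z * Dy m K z)"
    using hder_Dy_radial[OF smooth_K z, of l] by simp
  have "(\<Sum>j\<in>UNIV. snd z $ j * hder j (curv_form l) z) =
      1/3 * (F z * F z) * (\<Sum>j\<in>UNIV. snd z $ j * hder j (Dy l K) z) + F z * Dy l F z * K_dot z
      + K z * F z * (\<Sum>j\<in>UNIV. snd z $ j * hder j (Dy l F) z)"
    unfolding K_dot_def sum_distrib_left sum.distrib[symmetric] curv_form_def
    by (rule sum.cong) (use z in \<open>simp_all add: hder_simps hder_F algebra_simps\<close>)
  moreover have "(\<Sum>j\<in>UNIV. N j l z * curv_form j z) = 1/3 * (F z * F z) * (\<Sum>j\<in>UNIV. N j l z * Dy j K z)
      + K z * F z * (\<Sum>j\<in>UNIV. N j l z * Dy j F z)"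
    unfolding sum_distrib_left sum.distrib[symmetric] curv_form_def
    by (rule sum.cong) (simp_all add: algebra_simps)
  moreover have "(\<Sum>j\<in>UNIV. snd z $ j * hder l (curv_form j) z)
      = (\<Sum>j\<in>UNIV. snd z $ j * hder j (curv_form l) z)"
    using d_curv_form_radial[OF z, of l] by (simp add: d_curv_form_def right_diff_distrib sum_subtractf)
  ultimately have "F z * (4 * F z * hder l K z) = F z * (F z * Dy l K_dot z + 3 * K_dot z * Dy l F z)"
    unfolding 1 2 3 by (simp add: algebra_simps)
  then show ?thesis using F_nonzero[OF z] by simp
qed

lemma scalar_curvature_cyclic:
  fixes i j k :: 'n
  assumes z: "z \<in> S"
  defines "D \<equiv> \<lambda>i j. hder j (Dy i K) z - (\<Sum>m\<in>UNIV. \<Gamma> m i j z * Dy m K z)"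
  shows "(D j i - D i j) * Dy k F z + (D i k - D k i) * Dy j F z + (D k j - D j k) * Dy i F z = 0"
proof -
  \<comment> \<open>Division by \<open>F\<close> turns d_j K into a gradient plus a function times
    the gradient of \<open>F\<close>. Antisymmetrising the vertical derivative then removes every
    second derivative of \<open>K_dot\<close> and \<open>F\<close>, and in the cyclic sum each
    product Q_.a F_.b F_.c occurs with both signs.\<close>
  define Q where "Q = (\<lambda>z. K_dot z / F z)"
  have Q [simp]: "smooth_on Q S"
    unfolding Q_def using F_nonzero by (intro smooth_on_divide) auto
  have h: "hder j K w = 1/4 * Dy j K_dot w + 3/4 * (Q w * Dy j F w)" if "w \<in> S" for w j
    using hder_K_eq[OF that, of j] F_nonzero[OF that] by (simp add: Q_def field_simps)
  have "D i j - D j i = 3/4 * (Dy i Q z * Dy j F z - Dy j Q z * Dy i F z)" for i j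
  proof -
    have "D i j = Dy i (hder j K) z" for i j
      using Dy_hder[OF smooth_K z, of i j] \<Gamma>_sym[OF z, where j=i and k=j] by (simp add: D_def)
    also have "Dy i (hder j K) z = Dy i (\<lambda>w. 1/4 * Dy j K_dot w + 3/4 * (Q w * Dy j F w)) z" for i j
      using z by (intro Dy_cong h)
    also have "\<dots> i j = 1/4 * Dy i (Dy j K_dot) z + 3/4 * (Dy i Q z * Dy j F z
        + Q z * Dy i (Dy j F) z)" for i j
      using z by (simp add: D_simps)
    finally show ?thesis
      using Dy_Dy[OF smooth_F z, of i j] Dy_Dy[OF smooth_K_dot z, of i j] by (simp add: algebra_simps)
  qed
  note D = this
  show ?thesis unfolding D[of j i] D[of i k] D[of k j] by (simp add: algebra_simps)
qed

end

section \<open>The geodesic spray of a local Finsler metric\<close>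

lemma smooth_on_det:
  fixes M :: "'a::real_normed_vector \<Rightarrow> real^'n^'n"
  assumes "open S" "\<And>i j. smooth_on (\<lambda>z. M z $ i $ j) S"
  shows "smooth_on (\<lambda>z. det (M z)) S"
  unfolding det_def using assms
  by (intro smooth_on_sum smooth_on_mult smooth_on_prod smooth_on_const) auto

lemma matrix_inv_eq:
  fixes A :: "real^'n^'n"
  assumes "invertible A"
  shows "A ** matrix_inv A = mat 1" "matrix_inv A ** A = mat 1"
  using someI_ex[OF assms[unfolded invertible_def]] by (simp_all add: matrix_inv_def)

text \<open>Cramer's rule for the \<open>l\<close>-th unit vector: the entries become quotients of
  determinants, which are visibly smooth.\<close>

lemma matrix_inv_component:
  fixes A :: "real^'n^'n"
  assumes "invertible A"
  shows "matrix_inv A $ i $ l = det (\<chi> r c. if c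
      = i then axis l 1 $ r else A $ r $ c) * inverse (det A)"
proof -
  have "A *v (matrix_inv A *v axis l 1) = axis l 1"
    by (simp add: matrix_vector_mul_assoc matrix_inv_eq[OF assms])
  then have "matrix_inv A *v axis l 1 = (\<chi> k. det (\<chi> r c. if c
      = k then axis l 1 $ r else A $ r $ c) / det A)"
    using cramer[of A] assms by (simp add: invertible_det_nz)
  moreover have "(matrix_inv A *v axis l 1) $ i = matrix_inv A $ i $ l"
    by (simp add: matrix_vector_mult_basis column_def)
  ultimately show ?thesis by (simp add: divide_inverse)
qed

lemma smooth_on_matrix_inv:
  fixes M :: "'a::real_normed_vector \<Rightarrow> real^'n^'n"
  assumes S: "open S" and M: "\<And>i j. smooth_on (\<lambda>z. M z $ i $ j) S"
      and inv: "\<And>z. z \<in> S \<Longrightarrow> invertible (M z)"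
  shows "smooth_on (\<lambda>z. matrix_inv (M z) $ i $ l) S"
proof (rule smooth_on_cong[OF S])
  show "smooth_on (\<lambda>z. det (\<chi> r c. if c
      = i then axis l 1 $ r else M z $ r $ c) * inverse (det (M z))) S"
  proof (intro smooth_on_mult smooth_on_inverse smooth_on_det S M)
    show "smooth_on (\<lambda>z. (\<chi> r c. if c = i then axis l 1 $ r else M z $ r $ c) $ p $ q) S" for p q
      using M by (cases "q = i") simp_all
    show "det (M z) \<noteq> 0" if "z \<in> S" for z using inv[OF that] by (simp add: invertible_det_nz)
  qed
qed (simp add: matrix_inv_component[OF inv])

lemma pos_def_invertible:
  fixes A :: "real^'n^'n"
  assumes "\<And>u. u \<noteq> 0 \<Longrightarrow> u \<bullet> (A *v u) > 0"
  shows "invertible A"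
  unfolding invertible_left_inverse matrix_left_invertible_ker
  using assms by (metis inner_zero_right less_irrefl)

section \<open>Euler's theorem for homogeneous functions\<close>

context phase_space
begin

text \<open>In direction (0, y) the function is (1 + t) f(z), with derivative f(z); linearity of the
  Frechet derivative splits y into basis vectors.\<close>

lemma euler_homogeneous:
  assumes f: "smooth_on f S" and z: "z \<in> S"
    and hom: "\<And>t. t > 0 \<Longrightarrow> f (fst z, t *\<^sub>R snd z) = t * f z"
  shows "(\<Sum>j\<in>UNIV. snd z $ j * Dy j f z) = f z"
proof -
  let ?v = "(0 :: real^'n, snd z)"
  \<comment> \<open>Homogeneity is available for positive factors, and 1 + t is positive near t =
    0.\<close>
  have "\<forall>\<^sub>F t in nhds 0. t > (-1::real)"
    using eventually_nhds_in_open[of "{-1<..}" "0::real"] by simp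
  moreover have "f (z + t *\<^sub>R ?v) = (1 + t) * f z" if "t > -1" for t
  proof -
    have "z + t *\<^sub>R ?v = (fst z, (1 + t) *\<^sub>R snd z)" by (cases z) (simp add: scaleR_add_left)
    then show ?thesis using hom[of "1 + t"] that by simp
  qed
  ultimately have "\<forall>\<^sub>F t in nhds 0. f (z + t *\<^sub>R ?v) = (1 + t) * f z"
    by (auto elim: eventually_mono)
  then have "dir_deriv ?v f z = deriv (\<lambda>t. (1 + t) * f z) 0"
    unfolding dir_deriv_def by (intro deriv_cong_ev) auto
  also have "\<dots> = f z"
    by (rule DERIV_imp_deriv) (auto intro!: derivative_eq_intros)
  finally have 1: "frechet_derivative f (at z) ?v = f z"
    by (simp add: dir_deriv_eq_frechet[OF f z])
  have "linear (frechet_derivative f (at z))"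
    using smooth_on_imp_differentiable[OF f z] linear_frechet_derivative by blast
  moreover have "?v = (\<Sum>j\<in>UNIV. snd z $ j *\<^sub>R (0, axis j 1))"
    by (simp add: prod_eq_iff fst_sum snd_sum vec_eq_iff sum_component axis_def if_distrib cong: if_cong)
  ultimately have "frechet_derivative f (at z) ?v
      = (\<Sum>j\<in>UNIV. snd z $ j * frechet_derivative f (at z) (0, axis j 1))"
    by (simp only: linear_sum linear_cmul real_scaleR_def)
  then show ?thesis by (simp add: 1 Dy_eq_dir_deriv dir_deriv_eq_frechet[OF f z])
qed

lemma euler_derivative_Dx:
  assumes f: "smooth_on f S" and e: "\<And>z. z \<in> S \<Longrightarrow> (\<Sum>j\<in>UNIV. snd z $ j * Dy j f z) = c * f z"
    and z: "z \<in> S"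
  shows "(\<Sum>j\<in>UNIV. snd z $ j * Dy j (Dx l f) z) = c * Dx l f z"
proof -
  have "Dx l (\<lambda>z. \<Sum>j\<in>UNIV. snd z $ j * Dy j f z) z = Dx l (\<lambda>z. c * f z) z"
    using z by (intro Dx_cong e)
  then show ?thesis using f z by (simp add: D_simps Dx_Dy)
qed

text \<open>\<open>Dy l\<close> also hits the factor y^l, which lowers the degree by one; an
  x-derivative keeps it.\<close>

lemma euler_derivative_Dy:
  assumes f: "smooth_on f S" and e: "\<And>z. z \<in> S \<Longrightarrow> (\<Sum>j\<in>UNIV. snd z $ j * Dy j f z) = c * f z"
    and z: "z \<in> S"
  shows "(\<Sum>j\<in>UNIV. snd z $ j * Dy j (Dy l f) z) = (c - 1) * Dy l f z"
proof -
  have "Dy l (\<lambda>z. \<Sum>j\<in>UNIV. snd z $ j * Dy j f z) z = Dy l (\<lambda>z. c * f z) z"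
    using z by (intro Dy_cong e)
  then show ?thesis using f z by (simp add: D_simps sum.distrib Dy_Dy[of f z l] algebra_simps)
qed

end

locale finsler_local = phase_space S for S :: "((real^'n::finite) \<times> (real^'n)) set" +
  fixes L :: "(real^'n) \<times> (real^'n) \<Rightarrow> real"
  assumes smooth_L [simp]: "smooth_on L S"
    and L_nonzero: "z \<in> S \<Longrightarrow> L z \<noteq> 0"
    and euler_L: "z \<in> S \<Longrightarrow> (\<Sum>j\<in>UNIV. snd z $ j * Dy j L z) = L z"
    and fund_tensor_pos: "z \<in> S \<Longrightarrow> u \<noteq> 0 \<Longrightarrow> u \<bullet> (fund_tensor L z *v u) > 0"
begin

abbreviation E :: "(real^'n) \<times> (real^'n) \<Rightarrow> real"
  where "E \<equiv> \<lambda>w. (L w)\<^sup>2"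

abbreviation G :: "'n \<Rightarrow> (real^'n) \<times> (real^'n) \<Rightarrow> real"
  where "G \<equiv> geod_coeff L"

lemma smooth_E: "smooth_on E S"
  by simp

lemma invertible_fund_tensor: "z \<in> S \<Longrightarrow> invertible (fund_tensor L z)"
  by (rule pos_def_invertible) (rule fund_tensor_pos)

lemma smooth_geod_coeff: "smooth_on (G i) S"
proof -
  have "smooth_on (\<lambda>z. matrix_inv (fund_tensor L z) $ i $ l) S" for l
    by (rule smooth_on_matrix_inv) (simp_all add: invertible_fund_tensor, simp add: fund_tensor_def)
  then show ?thesis by (simp add: geod_coeff_def[abs_def])
qed

lemma Dy_E: "z \<in> S \<Longrightarrow> Dy j E z = 2 * L z * Dy j L z"
  and Dx_E: "z \<in> S \<Longrightarrow> Dx j E z = 2 * L z * Dx j L z"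
  by (simp_all add: power2_eq_square D_simps)

lemma euler_E:
  assumes z: "z \<in> S"
  shows "(\<Sum>j\<in>UNIV. snd z $ j * Dy j E z) = 2 * E z"
proof -
  have "(\<Sum>j\<in>UNIV. snd z $ j * Dy j E z) = 2 * L z * (\<Sum>j\<in>UNIV. snd z $ j * Dy j L z)"
    by (simp add: Dy_E[OF z] sum_distrib_left mult_ac)
  then show ?thesis by (simp add: euler_L[OF z] power2_eq_square)
qed

lemma euler_Dx_E: "z \<in> S \<Longrightarrow> (\<Sum>j\<in>UNIV. snd z $ j * Dy j (Dx m E) z) = 2 * Dx m E z"
  by (rule euler_derivative_Dx[OF smooth_E euler_E])

lemma euler_Dy_E: "z \<in> S \<Longrightarrow> (\<Sum>j\<in>UNIV. snd z $ j * Dy j (Dy l E) z) = Dy l E z"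
  using euler_derivative_Dy[OF smooth_E euler_E, of z l] by simp

lemma euler_Dy_Dx_E: "z \<in> S \<Longrightarrow> (\<Sum>j\<in>UNIV. snd z $ j * Dy j (Dy l (Dx m E)) z) = Dy l (Dx m E) z"
  using euler_derivative_Dy[OF smooth_Dx[OF smooth_E] euler_Dx_E, of z l m] by simp

lemma euler_Dy_Dy_E:
  assumes z: "z \<in> S"
  shows "(\<Sum>j\<in>UNIV. snd z $ j * Dy j (Dy i (Dy l E)) z) = 0"
  using euler_derivative_Dy[of "Dy l E" 1 z i] euler_Dy_E z by simp

text \<open>The definition of \<open>G\<close> with the inverse matrix cleared. Derivative
  identities for \<open>G\<close> start from this form, so no derivative of the inverse has to be
  computed.\<close>

lemma fund_tensor_geod_coeff:
  assumes z: "z \<in> S"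
  shows "2 * (\<Sum>i\<in>UNIV. Dy i (Dy l E) z * G i z) = (\<Sum>m\<in>UNIV. Dy l (Dx m E) z * snd z $ m) - Dx l E z"
proof -
  let ?g = "fund_tensor L z"
  let ?b = "\<chi> l. (\<Sum>m\<in>UNIV. Dy l (Dx m E) z * snd z $ m) - Dx l E z"
  have "(\<chi> i. G i z) = (1/4) *\<^sub>R (matrix_inv ?g *v ?b)"
    by (simp add: vec_eq_iff geod_coeff_def matrix_vector_mult_def)
  then have "?g *v (\<chi> i. G i z) = (1/4) *\<^sub>R ?b"
    by (simp add: matrix_vector_mult_scaleR matrix_vector_mul_assoc matrix_inv_eq invertible_fund_tensor[OF z])
  then have "(?g *v (\<chi> i. G i z)) $ l = 1/4 * ?b $ l" by simp
  moreover have "(?g *v (\<chi> i. G i z)) $ l = 1/2 * (\<Sum>i\<in>UNIV. Dy i (Dy l E) z * G i z)"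
    by (simp add: matrix_vector_mult_def fund_tensor_def sum_divide_distrib)
  ultimately show ?thesis by simp
qed

lemma hessian_E_injective:
  assumes z: "z \<in> S" and u: "\<And>l. (\<Sum>i\<in>UNIV. Dy i (Dy l E) z * u i) = 0"
  shows "u i = 0"
proof -
  have "(fund_tensor L z *v (\<chi> i. u i)) $ l = 1/2 * (\<Sum>i\<in>UNIV. Dy i (Dy l E) z * u i)" for l
    by (simp add: matrix_vector_mult_def fund_tensor_def sum_divide_distrib)
  then have "fund_tensor L z *v (\<chi> i. u i) = 0" by (simp add: vec_eq_iff u)
  then have "(\<chi> i. u i) = 0" using fund_tensor_pos[OF z] by (metis inner_zero_right less_irrefl)
  then show ?thesis by (simp add: vec_eq_iff)
qed

text \<open>Apply y^j \<open>Dy j\<close> to the cleared equation: the Hessian of \<open>E\<close>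
  has degree zero and the right-hand side degree two, so the Hessian annihilates the defect, and it
  is injective.\<close>

lemma euler_geod_coeff:
  assumes z: "z \<in> S"
  shows "(\<Sum>j\<in>UNIV. snd z $ j * Dy j (G i) z) = 2 * G i z"
proof -
  note [simp] = smooth_geod_coeff
  have "(\<Sum>i\<in>UNIV. Dy i (Dy l E) z * ((\<Sum>j\<in>UNIV. snd z $ j * Dy j (G i) z) - 2 * G i z)) = 0" for l
  proof -
    have "Dy j (\<lambda>z. 2 * (\<Sum>i\<in>UNIV. Dy i (Dy l E) z * G i z)) z
       = Dy j (\<lambda>z. (\<Sum>m\<in>UNIV. Dy l (Dx m E) z * snd z $ m) - Dx l E z) z" for j
      using z by (intro Dy_cong fund_tensor_geod_coeff)
    then have D: "2 * (\<Sum>i\<in>UNIV. Dy j (Dy i (Dy l E)) z * G i z + Dy i (Dy l E) z * Dy j (G i) z)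
       = (\<Sum>m\<in>UNIV. Dy j (Dy l (Dx m E)) z * snd z $ m) + Dy l (Dx j E) z - Dy j (Dx l E) z" for j
      using z by (simp add: D_simps sum.distrib)
    have "(\<Sum>j\<in>UNIV. snd z $ j * (2 * (\<Sum>i\<in>UNIV. Dy j (Dy i (Dy l E)) z * G i z
        + Dy i (Dy l E) z * Dy j (G i) z)))
      = 2 * (\<Sum>i\<in>UNIV. (\<Sum>j\<in>UNIV. snd z $ j * Dy j (Dy i (Dy l E)) z) * G i z
         + Dy i (Dy l E) z * (\<Sum>j\<in>UNIV. snd z $ j * Dy j (G i) z))"
      unfolding sum_distrib_left sum_distrib_right sum.distrib[symmetric]
      by (subst sum.swap) (simp add: algebra_simps)
    moreover have "(\<Sum>j\<in>UNIV. snd z $ j * ((\<Sum>m\<in>UNIV. Dy j (Dy l (Dx m E)) z * snd z $ m)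
        + Dy l (Dx j E) z - Dy j (Dx l E) z))
      = (\<Sum>m\<in>UNIV. (\<Sum>j\<in>UNIV. snd z $ j * Dy j (Dy l (Dx m E)) z) * snd z $ m)
        + (\<Sum>m\<in>UNIV. Dy l (Dx m E) z * snd z $ m) - (\<Sum>j\<in>UNIV. snd z $ j * Dy j (Dx l E) z)"
    proof -
      have "(\<Sum>j\<in>UNIV. snd z $ j * (\<Sum>m\<in>UNIV. Dy j (Dy l (Dx m E)) z * snd z $ m))
        = (\<Sum>m\<in>UNIV. (\<Sum>j\<in>UNIV. snd z $ j * Dy j (Dy l (Dx m E)) z) * snd z $ m)"
        unfolding sum_distrib_left sum_distrib_right by (subst sum.swap) (simp add: mult.assoc)
      then show ?thesis by (simp add: distrib_left right_diff_distrib sum.distrib sum_subtractf mult.commute)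
    qed
    ultimately have "2 * (\<Sum>i\<in>UNIV. Dy i (Dy l E) z * (\<Sum>j\<in>UNIV. snd z $ j * Dy j (G i) z))
      = 2 * ((\<Sum>m\<in>UNIV. Dy l (Dx m E) z * snd z $ m) - Dx l E z)"
      unfolding D by (simp add: euler_Dy_Dy_E[OF z] euler_Dy_Dx_E[OF z] euler_Dx_E[OF z])
    moreover have "(\<Sum>i\<in>UNIV. Dy i (Dy l E) z * (u i - 2 * G i z))
      = (\<Sum>i\<in>UNIV. Dy i (Dy l E) z * u i) - 2 * (\<Sum>i\<in>UNIV. Dy i (Dy l E) z * G i z)" for u
      by (simp add: right_diff_distrib sum_subtractf sum_distrib_left[of 2] mult.left_commute)
    ultimately show ?thesis
      unfolding fund_tensor_geod_coeff[OF z, symmetric] by simp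
  qed
  from hessian_E_injective[OF z this, of i] show ?thesis by simp
qed

sublocale spray S G
  by unfold_locales (simp_all add: smooth_geod_coeff euler_geod_coeff)

text \<open>Conservation of energy: the spray derivative of \<open>E\<close> vanishes. It follows by
  contracting the cleared equation with y^l.\<close>

lemma geod_coeff_radial:
  assumes z: "z \<in> S"
  shows "2 * (\<Sum>i\<in>UNIV. Dy i E z * G i z) = (\<Sum>m\<in>UNIV. snd z $ m * Dx m E z)"
proof -
  have "(\<Sum>l\<in>UNIV. snd z $ l * (2 * (\<Sum>i\<in>UNIV. Dy i (Dy l E) z * G i z)))
    = 2 * (\<Sum>i\<in>UNIV. (\<Sum>l\<in>UNIV. snd z $ l * Dy l (Dy i E) z) * G i z)"
    unfolding sum_distrib_left sum_distrib_right
    by (subst sum.swap) (simp add: mult_ac Dy_Dy[OF smooth_E z])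
  moreover have "(\<Sum>l\<in>UNIV. snd z $ l * ((\<Sum>m\<in>UNIV. Dy l (Dx m E) z * snd z $ m) - Dx l E z))
    = (\<Sum>m\<in>UNIV. (\<Sum>l\<in>UNIV. snd z $ l * Dy l (Dx m E) z) * snd z $ m) - (\<Sum>l\<in>UNIV. snd z $ l * Dx l E z)"
    unfolding right_diff_distrib sum_subtractf sum_distrib_left sum_distrib_right
    by (subst sum.swap) (simp add: mult.assoc)
  ultimately have "2 * (\<Sum>i\<in>UNIV. Dy i E z * G i z)
    = (\<Sum>m\<in>UNIV. 2 * Dx m E z * snd z $ m) - (\<Sum>l\<in>UNIV. snd z $ l * Dx l E z)"
    unfolding fund_tensor_geod_coeff[OF z] euler_Dy_E[OF z] euler_Dx_E[OF z] by simp
  then show ?thesis unfolding sum_subtractf[symmetric] by (simp add: algebra_simps)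
qed

text \<open>Differentiating energy conservation in y^l and inserting the cleared equation for
  \<open>G\<close> leaves d_l E = 0, which is 2 L d_l L = 0.\<close>

lemma hder_L:
  assumes z: "z \<in> S"
  shows "hder l L z = 0"
proof -
  have "Dy l (\<lambda>z. 2 * (\<Sum>i\<in>UNIV. Dy i E z * G i z)) z = Dy l (\<lambda>z. \<Sum>m\<in>UNIV. snd z $ m * Dx m E z) z"
    using z by (intro Dy_cong geod_coeff_radial)
  then have "2 * (\<Sum>i\<in>UNIV. Dy i (Dy l E) z * G i z) + 2 * (\<Sum>i\<in>UNIV. Dy i E z * N i l z)
     = Dx l E z + (\<Sum>m\<in>UNIV. Dy l (Dx m E) z * snd z $ m)"
    using z by (simp add: D_simps sum.distrib Dy_Dy[OF smooth_E z, of l] mult.commute)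
  then have "Dx l E z - (\<Sum>i\<in>UNIV. N i l z * Dy i E z) = 0"
    unfolding fund_tensor_geod_coeff[OF z] by (simp add: mult.commute)
  moreover have "Dx l E z - (\<Sum>i\<in>UNIV. N i l z * Dy i E z) = 2 * L z * hder l L z"
    by (simp add: hder_def Dx_E[OF z] Dy_E[OF z] right_diff_distrib sum_distrib_left mult_ac)
  ultimately show ?thesis using L_nonzero[OF z] by simp
qed

lemma riemann_curv_eq_jacobi: "z \<in> S \<Longrightarrow> riemann_curv L i k z = jacobi i k z"
  by (simp add: riemann_curv_def jacobi_def curv_contract_last)

lemma scalar_curvature_berwald_cyclic:
  fixes i j k :: 'n
  assumes K: "\<And>z i k. z \<in> S \<Longrightarrow>
      riemann_curv L i k z = K z * ((L z)\<^sup>2 * (if i = k then 1 else 0) - L z * Dy k L z * snd z $ i)"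
    and z: "z \<in> S"
  defines "D \<equiv> \<lambda>i j. berwald_hcov L (\<lambda>l. Dy l K) i j z"
  shows "(D j i - D i j) * Dy k L z + (D i k - D k i) * Dy j L z + (D k j - D j k) * Dy i L z = 0"
proof (cases "i = j \<or> j = k \<or> i = k")
  \<comment> \<open>The split is on the indices: with two equal ones the sum cancels formally,
    whatever \<open>K\<close> is; three distinct ones supply the dimension bound.\<close>
  case True
  then show ?thesis by (auto simp: algebra_simps)
next
  case False
  then have "card {i, j, k} = 3" by auto
  then have "CARD('n) \<ge> 3" by (metis card_mono finite subset_UNIV)
  then interpret scalar_spray S G L K
    by unfold_locales (simp_all add: L_nonzero euler_L hder_L riemann_curv_eq_jacobi[symmetric] K)
  have "D i j = hder j (Dy i K) z - (\<Sum>m\<in>UNIV. \<Gamma> m i j z * Dy m K z)" for i j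
    by (simp add: D_def berwald_hcov_def hder_def)
  then show ?thesis using scalar_curvature_cyclic[OF z, where i=i and j=j and k=k] by simp
qed

end

section \<open>Finsler metrics in a chart\<close>

locale manifold =
  fixes X :: "'m topology" and A :: "('m, 'n::finite) chart set"
  assumes manifold: "smooth_manifold X A"
begin

lemma
  assumes "c \<in> A"
  shows openin_chart_dom: "openin X (chart_dom c)"
    and open_chart_range: "open (chart_range c)"
    and chart_homeomorphic:
      "homeomorphic_map (subtopology X (chart_dom c)) (top_of_set (chart_range c)) (chart_map c)"
  using manifold assms unfolding smooth_manifold_def by blast+

lemma chart_dom_subset: "c \<in> A \<Longrightarrow> chart_dom c \<subseteq> topspace X"
  using openin_chart_dom openin_subset by blast

lemma chart_inj: "c \<in> A \<Longrightarrow> inj_on (chart_map c) (chart_dom c)"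
  using homeomorphic_imp_injective_map[OF chart_homeomorphic] chart_dom_subset
  by (simp add: Int_absorb1)

lemma chart_inv_map: "c \<in> A \<Longrightarrow> p \<in> chart_dom c \<Longrightarrow> chart_inv c (chart_map c p) = p"
  unfolding chart_inv_def by (rule inv_into_f_f[OF chart_inj])

lemma chart_inv_in: "x \<in> chart_range c \<Longrightarrow> chart_inv c x \<in> chart_dom c"
  unfolding chart_inv_def chart_range_def by (rule inv_into_into)

lemma transition_chart_map:
  "c \<in> A \<Longrightarrow> p \<in> chart_dom c \<Longrightarrow> transition c d (chart_map c p) = chart_map d p"
  by (simp add: transition_def chart_inv_map)

text \<open>Overlaps of charts become open coordinate sets, so transition derivatives depend only on
  values there.\<close>

lemma open_chart_image:
  assumes "c \<in> A" "openin X U" "U \<subseteq> chart_dom c"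
  shows "open (chart_map c ` U)"
proof -
  have "openin (subtopology X (chart_dom c)) U"
    using assms by (simp add: openin_subset_topspace_eq openin_open_subtopology openin_chart_dom)
  then have "openin (top_of_set (chart_range c)) (chart_map c ` U)"
    using chart_homeomorphic[OF assms(1)] assms(3) chart_dom_subset[OF assms(1)]
    by (metis homeomorphic_imp_open_map open_map_def)
  then show ?thesis using open_chart_range[OF assms(1)] by (simp add: openin_open_eq)
qed

lemma transition_differentiable:
  assumes "c \<in> A" "d \<in> A" "p \<in> chart_dom c" "p \<in> chart_dom d"
  shows "transition c d differentiable (at (chart_map c p))"
proof (rule smooth_on_imp_differentiable)
  show "smooth_on (transition c d) (chart_map c ` (chart_dom c \<inter> chart_dom d))"
    using manifold assms unfolding smooth_manifold_def by blast
qed (use assms in auto)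

lemma frechet_transition_self:
  assumes "c \<in> A" "p \<in> chart_dom c"
  shows "frechet_derivative (transition c c) (at (chart_map c p)) y = y"
proof -
  have "frechet_derivative (transition c c) (at (chart_map c p))
      = frechet_derivative (\<lambda>x. x) (at (chart_map c p))"
    using assms open_chart_range
    by (intro frechet_derivative_cong_open[of "chart_range c"])
      (auto simp: chart_range_def transition_chart_map)
  then show ?thesis by simp
qed

text \<open>The chain rule on the open image of the triple overlap. This is the compatibility that
  makes \<open>coord_vector\<close> a tangent vector.\<close>

lemma frechet_transition_compose:
  assumes "c \<in> A" "d \<in> A" "e \<in> A" "p \<in> chart_dom c" "p \<in> chart_dom d" "p \<in> chart_dom e"
  shows "frechet_derivative (transition c e) (at (chart_map c p)) y =
    frechet_derivative (transition d e) (at (chart_map d p))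
      (frechet_derivative (transition c d) (at (chart_map c p)) y)"
proof -
  let ?x = "chart_map c p" and ?U = "chart_dom c \<inter> chart_dom d \<inter> chart_dom e"
  have U: "open (chart_map c ` ?U)"
    using assms by (intro open_chart_image openin_Int openin_chart_dom) auto
  have x: "transition c d ?x = chart_map d p" using assms by (simp add: transition_chart_map)
  have "frechet_derivative (transition c e) (at ?x)
      = frechet_derivative (transition d e \<circ> transition c d) (at ?x)"
    using assms by (intro frechet_derivative_cong_open[OF U]) (auto simp: transition_chart_map)
  also have "\<dots> = frechet_derivative (transition d e) (at (transition c d ?x))
      \<circ> frechet_derivative (transition c d) (at ?x)"
    using assms by (intro frechet_derivative_compose) (simp_all add: transition_differentiable x)
  finally show ?thesis by (simp add: x)
qed

lemma coord_vector_in_tangent_space: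
  assumes "c \<in> A" "p \<in> chart_dom c"
  shows "coord_vector A c p y \<in> tangent_space A p"
  using assms unfolding tangent_space_def coord_vector_def
  by (auto intro!: frechet_transition_compose)

lemma coord_vector_eq_0_iff:
  assumes "c \<in> A" "p \<in> chart_dom c"
  shows "coord_vector A c p y = (\<lambda>_. 0) \<longleftrightarrow> y = 0"
proof
  assume "coord_vector A c p y = (\<lambda>_. 0)"
  then have "coord_vector A c p y c = 0" by simp
  then show "y = 0" using assms by (simp add: coord_vector_def frechet_transition_self)
next
  assume "y = 0"
  then show "coord_vector A c p y = (\<lambda>_. 0)"
    using assms linear_0[OF linear_frechet_derivative[OF transition_differentiable]]
    by (auto simp: coord_vector_def fun_eq_iff)
qed

lemma coord_vector_scaleR:
  assumes "c \<in> A" "p \<in> chart_dom c"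
  shows "coord_vector A c p (t *\<^sub>R y) = (\<lambda>d. t *\<^sub>R coord_vector A c p y d)"
  using assms linear_cmul[OF linear_frechet_derivative[OF transition_differentiable]]
  by (auto simp: coord_vector_def fun_eq_iff)

text \<open>The bridge from the manifold to coordinates: the axioms are tested on
  \<open>coord_vector\<close>, which is nonzero for nonzero \<open>y\<close> because its component
  in the chart \<open>c\<close> is \<open>y\<close> itself.\<close>

lemma finsler_local_local_rep:
  assumes F: "finsler_metric X A F" and c: "c \<in> A"
  shows "finsler_local (chart_range c \<times> - {0}) (local_rep A c F)"
proof -
  let ?S = "chart_range c \<times> - {0 :: real^'n}" and ?f = "local_rep A c F"
  have S: "open ?S" using open_chart_range[OF c] by (intro open_Times) auto
  then interpret phase_space ?S by unfold_locales
  have smooth: "smooth_on ?f ?S" using F c unfolding finsler_metric_def by blast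
  have top: "chart_inv c x \<in> chart_dom c" "chart_inv c x \<in> topspace X" if "x \<in> chart_range c" for x
    using chart_inv_in[OF that] chart_dom_subset[OF c] by blast+
  have hom: "?f (x, t *\<^sub>R y) = t * ?f (x, y)" if "x \<in> chart_range c" "t > 0" for x y t
    using F top[OF that(1)] that(2) coord_vector_in_tangent_space[OF c top(1)[OF that(1)]]
    unfolding finsler_metric_def local_rep_def
    by (simp add: coord_vector_scaleR[OF c top(1)[OF that(1)]])
  show ?thesis
  proof unfold_locales
    show "smooth_on ?f ?S" by (rule smooth)
    fix z assume z: "z \<in> ?S"
    then obtain x y where xy: "z = (x, y)" "x \<in> chart_range c" "y \<noteq> 0" by auto
    show "?f z \<noteq> 0"
      using F top[OF xy(2)] coord_vector_in_tangent_space[OF c top(1)[OF xy(2)], of y]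
        coord_vector_eq_0_iff[OF c top(1)[OF xy(2)], of y] xy(3)
      unfolding finsler_metric_def local_rep_def xy(1) by auto
    show "(\<Sum>j\<in>UNIV. snd z $ j * Dy j ?f z) = ?f z"
      by (rule euler_homogeneous[OF smooth z]) (simp add: xy hom)
    show "u \<bullet> (fund_tensor ?f z *v u) > 0" if "u \<noteq> 0" for u
      using F c xy that unfolding finsler_metric_def by blast
  qed
qed

end

theorem lemma3p2:
  fixes X :: "'m topology"
    and A :: "('m, 'n::finite) chart set"
    and F K :: "'m \<Rightarrow> ('m, 'n) tvec \<Rightarrow> real"
  assumes "smooth_manifold X A"
    and "finsler_metric X A F"
    and "scalar_flag_curvature A F K"
  shows "\<forall>c\<in>A. \<forall>x\<in>chart_range c. \<forall>y. y \<noteq> 0 \<longrightarrow> (\<forall>i j k.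
    (let f = local_rep A c F;
         \<kappa> = local_rep A c K;
         D = (\<lambda>i j. berwald_hcov f (\<lambda>l. Dy l \<kappa>) i j (x, y))
     in (D j i - D i j) * Dy k f (x, y)
        + (D i k - D k i) * Dy j f (x, y)
        + (D k j - D j k) * Dy i f (x, y) = 0))"
proof (intro ballI allI impI)
  fix c x and y :: "real^'n" and i j k
  assume c: "c \<in> A" and x: "x \<in> chart_range c" and y: "y \<noteq> 0"
  interpret manifold X A by unfold_locales (rule assms(1))
  interpret finsler_local "chart_range c \<times> - {0}" "local_rep A c F"
    by (rule finsler_local_local_rep[OF assms(2) c])
  have "riemann_curv (local_rep A c F) i k z = local_rep A c K z *
      ((local_rep A c F z)\<^sup>2 * (if i = k then 1 else 0)
        - local_rep A c F z * Dy k (local_rep A c F) z * snd z $ i)"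
    if "z \<in> chart_range c \<times> - {0}" for z i k
    using assms(3) c that unfolding scalar_flag_curvature_def by force
  from scalar_curvature_berwald_cyclic[OF this, of "(x, y)"] x y
  show "let f = local_rep A c F;
         \<kappa> = local_rep A c K;
         D = (\<lambda>i j. berwald_hcov f (\<lambda>l. Dy l \<kappa>) i j (x, y))
     in (D j i - D i j) * Dy k f (x, y)
        + (D i k - D k i) * Dy j f (x, y)
        + (D k j - D j k) * Dy i f (x, y) = 0"
    unfolding Let_def by blast
qed

end
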